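(* For all $m>0$, \[ \max\left(\frac{5m}7,\;m-1\right)<b^*(m)<\min\left(\frac{\left(5+\frac{37}{12}m\right)m}{7+\frac{37}{12}m},\; m-1+\frac{25}{7m}\right). \]
   Context: Consider the Bogdanov-Takens system $x'=y,\ y'=-m^2+by+x^2+xy$, with real parameters $m>0$ and $b$. Its critical points are $(m,0)$, a saddle, and $(-m,0)$. It is known that for every $m>0$ there is a unique real number $b^*(m)<m$ such that the system has a limit cycle (which is then unique, hyperbolic and unstable) if and only if $b^*(m)<b<m$. For $b=b^*(m)$ the system has a saddle-loop, that is, a homoclinic connection of the saddle $(m,0)$ surrounding $(-m,0)$. The curve $b=b^*(m)$ is called the saddle-loop bifurcation curve. *)

theory Defs
  imports "HOL-Analysis.Analysis"
begin

definition bt_field :: "real \<Rightarrow> real \<Rightarrow> real \<times> real \<Rightarrow> real \<times> real" where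
  "bt_field m b = (\<lambda>(x, y). (y, - m\<^sup>2 + b * y + x\<^sup>2 + x * y))"

definition bt_solution :: "real \<Rightarrow> real \<Rightarrow> (real \<Rightarrow> real \<times> real) \<Rightarrow> bool" where
  "bt_solution m b \<phi> \<longleftrightarrow> (\<forall>t. (\<phi> has_vector_derivative bt_field m b (\<phi> t)) (at t))"

definition periodic_orbit :: "real \<Rightarrow> real \<Rightarrow> (real \<times> real) set \<Rightarrow> bool" where
  "periodic_orbit m b \<Gamma> \<longleftrightarrow>
     (\<exists>\<phi> T. bt_solution m b \<phi> \<and> 0 < T \<and> (\<forall>t. \<phi> (t + T) = \<phi> t) \<and>
            (\<exists>t. \<phi> t \<noteq> \<phi> 0) \<and> \<Gamma> = range \<phi>)"

(* A limit cycle is a periodic orbit that is isolated among the periodic orbits. *)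
definition limit_cycle :: "real \<Rightarrow> real \<Rightarrow> (real \<times> real) set \<Rightarrow> bool" where
  "limit_cycle m b \<Gamma> \<longleftrightarrow>
     periodic_orbit m b \<Gamma> \<and>
     (\<exists>U. open U \<and> \<Gamma> \<subseteq> U \<and> (\<forall>\<Gamma>'. periodic_orbit m b \<Gamma>' \<and> \<Gamma>' \<subseteq> U \<longrightarrow> \<Gamma>' = \<Gamma>))"

(* "Surrounding" is expressed by "inside": the point lies in a bounded component of
   the complement of the closed curve formed by the orbit and the saddle. *)
definition has_saddle_loop :: "real \<Rightarrow> real \<Rightarrow> bool" where
  "has_saddle_loop m b \<longleftrightarrow>
     (\<exists>\<phi>. bt_solution m b \<phi> \<and> (\<exists>t. \<phi> t \<noteq> (m, 0)) \<and>
          (\<phi> \<longlongrightarrow> (m, 0)) at_bot \<and> (\<phi> \<longlongrightarrow> (m, 0)) at_top \<and>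
          (- m, 0) \<in> inside (insert (m, 0) (range \<phi>)))"

definition limit_cycle_threshold :: "real \<Rightarrow> real \<Rightarrow> bool" where
  "limit_cycle_threshold m B \<longleftrightarrow>
     B < m \<and> (\<forall>b. (\<exists>\<Gamma>. limit_cycle m b \<Gamma>) \<longleftrightarrow> B < b \<and> b < m)"

(* Meaningful only for those m for which the threshold exists; it is then unique,
   since the nonempty interval of b with a limit cycle determines its left endpoint. *)
definition b_star :: "real \<Rightarrow> real" where
  "b_star m = (THE B. limit_cycle_threshold m B)"

end

theory Submission
  imports Defs
begin

text \<open>
  In the coordinates \<open>z = 1 - x / m\<close>, \<open>u = y / m\<^sup>2\<close> with \<open>a = b / m + 1\<close> the system reads
  \<open>z' = - m u\<close>, \<open>u' = - z (2 - z) + m (a - z) u\<close>, and the saddle is the origin.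
  A saddle loop consists of a lower branch \<open>u < 0\<close>, along which \<open>z\<close> increases up to a turning point,
  and of an upper branch \<open>u > 0\<close> leading back.
  Each bound on \<open>b\<close> is proved by contradiction with an explicit algebraic barrier \<open>f\<close> through the saddle
  that satisfies a linear equation \<open>f' = K f + (source of constant sign)\<close> along the orbit; the behaviour
  at the saddle then fixes the sign of \<open>f\<close> on each branch, and the two branches end up
  at different turning points. The barriers are the line \<open>x + y = m\<close> for \<open>b > m - 1\<close>, curves quadratic
  in \<open>u\<close> that approximate the loop for \<open>b > 5 m / 7\<close> with \<open>m \<le> 7 / 2\<close> and for the upper bounds with
  \<open>m \<le> 11\<close>, and separate barriers for the two branches for \<open>m \<ge> 11\<close>. The two upper bounds cross
  at \<open>m = 7\<close>, so each is needed on one side only.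
\<close>

section \<open>Sign propagation for real functions\<close>

text \<open>The zero is the infimum of the closed set where \<open>f\<close> is nonpositive. The
  last clause is what barriers use: a differential inequality at \<open>c\<close> contradicts
  it.\<close>

lemma first_zero:
  fixes f :: "real \<Rightarrow> real"
  assumes cont: "\<And>t. t0 \<le> t \<Longrightarrow> isCont f t"
    and start: "f t0 > 0" and stop: "f t1 \<le> 0" and "t0 < t1"
  obtains c where "t0 < c" "c \<le> t1" "f c = 0" "\<And>t. \<lbrakk>t0 \<le> t; t < c\<rbrakk> \<Longrightarrow> f t > 0"
    "\<And>D. (f has_real_derivative D) (at c) \<Longrightarrow> D \<le> 0"
proof -
  define Z where "Z = {t \<in> {t0..t1}. f t \<le> 0}"
  have cont: "continuous_on {t0..t1} f"
    by (intro continuous_at_imp_continuous_on ballI cont) simp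
  have "closed Z" unfolding Z_def
    by (rule continuous_on_closed_Collect_le[OF cont continuous_on_const]) simp
  moreover have ne: "Z \<noteq> {}" "bdd_below Z" using assms by (auto simp: Z_def bdd_below_def)
  ultimately have mem: "Inf Z \<in> Z" by (simp add: closed_contains_Inf)
  define c where "c = Inf Z"
  have c: "t0 \<le> c" "c \<le> t1" "f c \<le> 0" using mem by (auto simp: Z_def c_def)
  have before: "f t > 0" if "t0 \<le> t" "t < c" for t
  proof (rule ccontr)
    assume "\<not> 0 < f t"
    then have "t \<in> Z" using that c by (auto simp: Z_def)
    then have "c \<le> t" unfolding c_def using ne by (intro cInf_lower)
    then show False using that by simp
  qed
  have "t0 < c" using c start by (cases "t0 = c") auto
  have "f c \<ge> 0"
  proof (rule ccontr)
    assume "\<not> 0 \<le> f c"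
    then obtain x where "t0 \<le> x" "x \<le> c" "f x = f c / 2"
      using IVT2'[of f c "f c / 2" t0] start c continuous_on_subset[OF cont, of "{t0..c}"] by auto
    moreover have "x \<noteq> c" using \<open>f x = f c / 2\<close> \<open>\<not> 0 \<le> f c\<close> by auto
    ultimately show False using before[of x] \<open>\<not> 0 \<le> f c\<close> by auto
  qed
  then have "f c = 0" using c by simp
  have "D \<le> 0" if D: "(f has_real_derivative D) (at c)" for D
  proof (rule ccontr)
    assume "\<not> D \<le> 0"
    then obtain d where d: "d > 0" "\<And>h. \<lbrakk>0 < h; h < d\<rbrakk> \<Longrightarrow> f (c - h) < f c"
      using DERIV_pos_inc_left[OF D] by auto
    define h where "h = min (d/2) ((c - t0)/2)"
    have "0 < h" "h < d" "t0 \<le> c - h" "c - h < c"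
      using d \<open>t0 < c\<close> by (auto simp: h_def min_def field_simps)
    then show False using before[of "c - h"] d(2)[of h] \<open>f c = 0\<close> by auto
  qed
  then show thesis using that[of c] \<open>t0 < c\<close> c \<open>f c = 0\<close> before by blast
qed

lemma last_zero:
  fixes f :: "real \<Rightarrow> real"
  assumes cont: "\<And>t. t \<le> t0 \<Longrightarrow> isCont f t"
    and start: "f t0 > 0" and stop: "f t1 \<le> 0" and "t1 < t0"
  obtains c where "t1 \<le> c" "c < t0" "f c = 0" "\<And>t. \<lbrakk>c < t; t \<le> t0\<rbrakk> \<Longrightarrow> f t > 0"
    "\<And>D. (f has_real_derivative D) (at c) \<Longrightarrow> D \<ge> 0"
proof -
  have "isCont (\<lambda>t. f (- t)) t" if "- t0 \<le> t" for t
    using isCont_o2[where f = uminus and g = f and a = t] cont[of "- t"] that by simp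
  from first_zero[of "- t0" "\<lambda>t. f (- t)" "- t1", OF this]
  obtain c where c: "- t0 < c" "c \<le> - t1" "f (- c) = 0"
      "\<And>t. \<lbrakk>- t0 \<le> t; t < c\<rbrakk> \<Longrightarrow> f (- t) > 0"
      "\<And>D. ((\<lambda>t. f (- t)) has_real_derivative D) (at c) \<Longrightarrow> D \<le> 0"
    using start stop \<open>t1 < t0\<close> by auto
  have "D \<ge> 0" if "(f has_real_derivative D) (at (- c))" for D
    using c(5)[of "- D"] that by (simp add: DERIV_mirror)
  moreover have "f t > 0" if "- c < t" "t \<le> t0" for t
    using c(4)[of "- t"] that by simp
  ultimately show thesis using that[of "- c"] c by auto
qed

text \<open>Zero can only be crossed upwards, so a first return to zero, where the derivative is at
  most 0, is impossible. If \<open>f t0 = 0\<close>, the positive derivative at \<open>t0\<close>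
  first lifts \<open>f\<close> above zero.\<close>

lemma pos_after_if_deriv_pos_at_zeros:
  fixes f f' :: "real \<Rightarrow> real"
  assumes der: "\<And>t. t0 \<le> t \<Longrightarrow> (f has_real_derivative f' t) (at t)"
    and start: "f t0 \<ge> 0"
    and zero: "\<And>t. \<lbrakk>t0 \<le> t; f t = 0\<rbrakk> \<Longrightarrow> f' t > 0"
    and "t0 < t1"
  shows "f t1 > 0"
proof (rule ccontr)
  assume neg: "\<not> f t1 > 0"
  obtain s where s: "t0 \<le> s" "s < t1" "f s > 0"
  proof (cases "f t0 = 0")
    case True
    from DERIV_pos_inc_right[OF der[OF order_refl] zero[OF order_refl True]]
    obtain d where d: "d > 0" "\<And>h. \<lbrakk>0 < h; h < d\<rbrakk> \<Longrightarrow> f t0 < f (t0 + h)" by blast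
    define h where "h = min (d/2) ((t1 - t0)/2)"
    have "0 < h" "h < d" "t0 + h < t1" using d \<open>t0 < t1\<close> by (auto simp: h_def min_def field_simps)
    then show ?thesis using that[of "t0 + h"] d(2)[of h] True by auto
  next
    case False
    then show ?thesis using that[of t0] start \<open>t0 < t1\<close> by auto
  qed
  have cont: "isCont f t" if "s \<le> t" for t using der[of t] s that by (auto intro: DERIV_isCont)
  have "f t1 \<le> 0" using neg by simp
  obtain c where c: "s < c" "f c = 0" "\<And>D. (f has_real_derivative D) (at c) \<Longrightarrow> D \<le> 0"
    by (rule first_zero[OF cont s(3) \<open>f t1 \<le> 0\<close> s(2)]) blast+
  show False using c(3)[OF der[of c]] zero[of c] c s by auto
qed

lemma pos_before_if_deriv_neg_at_zeros:
  fixes f f' :: "real \<Rightarrow> real"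
  assumes der: "\<And>t. t \<le> t0 \<Longrightarrow> (f has_real_derivative f' t) (at t)"
    and start: "f t0 \<ge> 0"
    and zero: "\<And>t. \<lbrakk>t \<le> t0; f t = 0\<rbrakk> \<Longrightarrow> f' t < 0"
    and "t1 < t0"
  shows "f t1 > 0"
proof -
  have "((\<lambda>t. f (- t)) has_real_derivative - f' (- t)) (at t)" if "- t0 \<le> t" for t
    using der[of "- t"] that by (simp add: DERIV_mirror)
  from pos_after_if_deriv_pos_at_zeros[of "- t0" "\<lambda>t. f (- t)" "\<lambda>t. - f' (- t)" "- t1", OF this]
  show ?thesis using start zero \<open>t1 < t0\<close> by auto
qed

text \<open>Positivity is asked for only strictly inside the interval, so that the lemma applies up
  to a turning point, where \<open>u\<close> vanishes.\<close>

lemma less_if_deriv_pos: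
  fixes f f' :: "real \<Rightarrow> real"
  assumes "s < t"
    and der: "\<And>r. \<lbrakk>s \<le> r; r \<le> t\<rbrakk> \<Longrightarrow> (f has_real_derivative f' r) (at r)"
    and pos: "\<And>r. \<lbrakk>s < r; r < t\<rbrakk> \<Longrightarrow> f' r > 0"
  shows "f s < f t"
proof -
  have "continuous_on {s..t} f"
    by (intro continuous_at_imp_continuous_on ballI) (auto intro: DERIV_isCont[OF der])
  moreover have "\<exists>y. (f has_real_derivative y) (at r) \<and> y > 0" if "s < r" "r < t" for r
    using der[of r] pos[of r] that by auto
  ultimately show ?thesis by (intro DERIV_pos_imp_increasing_open[OF \<open>s < t\<close>])
qed

section \<open>Sign propagation from limits at infinity\<close>

lemma tendsto_at_top_ge_of_ge:
  fixes f :: "real \<Rightarrow> real"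
  assumes "(f \<longlongrightarrow> l) at_top" "\<And>t. t \<ge> t0 \<Longrightarrow> f t \<ge> c"
  shows "l \<ge> c"
proof (rule tendsto_lowerbound[OF assms(1)])
  show "\<forall>\<^sub>F t in at_top. c \<le> f t"
    using eventually_ge_at_top[of t0] by (rule eventually_mono) (rule assms(2))
qed simp

lemma tendsto_at_bot_ge_of_ge:
  fixes f :: "real \<Rightarrow> real"
  assumes "(f \<longlongrightarrow> l) at_bot" "\<And>t. t \<le> t0 \<Longrightarrow> f t \<ge> c"
  shows "l \<ge> c"
proof (rule tendsto_lowerbound[OF assms(1)])
  show "\<forall>\<^sub>F t in at_bot. c \<le> f t"
    using eventually_le_at_bot[of t0] by (rule eventually_mono) (rule assms(2))
qed simp

text \<open>The hypothesis \<open>late\<close> is what the unstable direction of a linear equation provides: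
  once nonpositive, \<open>f\<close> is driven away from its limit \<open>0\<close>.\<close>
lemma pos_if_tendsto_0_at_top:
  fixes f f' :: "real \<Rightarrow> real"
  assumes der: "\<And>t. t0 \<le> t \<Longrightarrow> (f has_real_derivative f' t) (at t)"
    and lim: "(f \<longlongrightarrow> 0) at_top"
    and zero: "\<And>t. \<lbrakk>t0 \<le> t; f t = 0\<rbrakk> \<Longrightarrow> f' t < 0"
    and late: "\<forall>\<^sub>F t in at_top. f t < 0 \<longrightarrow> f' t < 0"
  shows "f t0 > 0"
proof (rule ccontr)
  assume "\<not> f t0 > 0"
  then have neg: "f t < 0" if "t0 < t" for t
    using pos_after_if_deriv_pos_at_zeros[of t0 "\<lambda>t. - f t" "\<lambda>t. - f' t" t] der zero that
    by (auto intro!: derivative_eq_intros)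
  obtain T where T: "\<And>t. t \<ge> T \<Longrightarrow> f t < 0 \<longrightarrow> f' t < 0"
    using late by (auto simp: eventually_at_top_linorder)
  \<comment> \<open>From \<open>S\<close> on, \<open>f\<close> is negative and decreasing, so its
    limit would be at most \<open>f S < 0\<close>.\<close>
  define S where "S = max T t0 + 1"
  have "- f S \<le> - f t" if "S \<le> t" for t
  proof (cases "S = t")
    case False
    have "- f S < - f t"
    proof (rule less_if_deriv_pos[where f = "\<lambda>t. - f t" and f' = "\<lambda>t. - f' t"])
      show "S < t" using False that by simp
      fix r assume "S \<le> r" "r \<le> t"
      then show "((\<lambda>t. - f t) has_real_derivative - f' r) (at r)"
        by (intro DERIV_minus der) (auto simp: S_def)
    next
      fix r assume "S < r" "r < t"
      then have "r \<ge> T" "t0 < r" by (auto simp: S_def)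
      then show "0 < - f' r" using T[of r] neg[of r] by simp
    qed
    then show ?thesis by simp
  qed auto
  then have "- 0 \<ge> - f S"
    by (intro tendsto_at_top_ge_of_ge[OF tendsto_minus[OF lim]])
  moreover have "f S < 0" using neg by (simp add: S_def)
  ultimately show False by simp
qed

text \<open>Backward in time a positive \<open>f\<close> may well decay to 0 along the unstable
  direction, so \<open>f\<close> is compared with \<open>z\<close>, which decays as well. By
  \<open>early\<close> a positive quotient decreases in time; towards the past it stays above a
  positive value and cannot tend to 0.\<close>

lemma neg_if_quotient_tendsto_0_at_bot:
  fixes f f' z z' :: "real \<Rightarrow> real"
  assumes der: "\<And>t. t \<le> t0 \<Longrightarrow> (f has_real_derivative f' t) (at t)"
    and derz: "\<And>t. t \<le> t0 \<Longrightarrow> (z has_real_derivative z' t) (at t)"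
    and zpos: "\<And>t. t \<le> t0 \<Longrightarrow> z t > 0"
    and lim: "((\<lambda>t. f t / z t) \<longlongrightarrow> 0) at_bot"
    and zero: "\<And>t. \<lbrakk>t \<le> t0; f t = 0\<rbrakk> \<Longrightarrow> f' t < 0"
    and early: "\<forall>\<^sub>F t in at_bot. f t > 0 \<longrightarrow> f' t * z t - f t * z' t < 0"
  shows "f t0 < 0"
proof (rule ccontr)
  assume "\<not> f t0 < 0"
  then have pos: "f t > 0" if "t < t0" for t
    using pos_before_if_deriv_neg_at_zeros[of t0 f f' t] der zero that by auto
  obtain T where T: "\<And>t. t \<le> T \<Longrightarrow> f t > 0 \<longrightarrow> f' t * z t - f t * z' t < 0"
    using early by (auto simp: eventually_at_bot_linorder)
  define S where "S = min T t0 - 1"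
  have derq: "((\<lambda>t. - (f t / z t)) has_real_derivative
      - ((f' t * z t - f t * z' t) / (z t * z t))) (at t)" if "t \<le> t0" for t
    using der[OF that] derz[OF that] zpos[OF that]
    by (auto intro!: derivative_eq_intros)
  have "f S / z S \<le> f t / z t" if "t \<le> S" for t
  proof (cases "t = S")
    case False
    have "- (f t / z t) < - (f S / z S)"
    proof (rule less_if_deriv_pos[where f = "\<lambda>t. - (f t / z t)"
          and f' = "\<lambda>r. - ((f' r * z r - f r * z' r) / (z r * z r))"])
      show "t < S" using False that by simp
      fix r assume "t \<le> r" "r \<le> S"
      then show "((\<lambda>t. - (f t / z t)) has_real_derivative
        - ((f' r * z r - f r * z' r) / (z r * z r))) (at r)"
        by (intro derq) (auto simp: S_def)
    next
      fix r assume "t < r" "r < S"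
      then have "r \<le> T" "r < t0" by (auto simp: S_def)
      then show "- ((f' r * z r - f r * z' r) / (z r * z r)) > 0"
        using T[of r] pos[of r] zpos[of r] by (auto intro!: divide_neg_pos)
    qed
    then show ?thesis by simp
  qed auto
  then have "0 \<ge> f S / z S"
    by (intro tendsto_at_bot_ge_of_ge[OF lim])
  moreover have "f S > 0" "z S > 0" using pos zpos by (auto simp: S_def)
  ultimately show False by (simp add: field_simps)
qed

lemma attains_max_if_tendsto_0:
  fixes f :: "real \<Rightarrow> real"
  assumes cont: "continuous_on UNIV f"
    and top: "(f \<longlongrightarrow> 0) at_top" and bot: "(f \<longlongrightarrow> 0) at_bot"
    and pos: "f t0 > 0"
  shows "\<exists>\<tau>. \<forall>t. f t \<le> f \<tau>"
proof -
  obtain T where T: "\<And>t. t \<ge> T \<Longrightarrow> f t < f t0"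
    using order_tendstoD(2)[OF top pos] by (auto simp: eventually_at_top_linorder)
  obtain S where S: "\<And>t. t \<le> S \<Longrightarrow> f t < f t0"
    using order_tendstoD(2)[OF bot pos] by (auto simp: eventually_at_bot_linorder)
  have "S < t0" "t0 < T" using S[of t0] T[of t0] by (auto simp: not_le[symmetric])
  then obtain \<tau> where \<tau>: "\<tau> \<in> {S..T}" "\<And>t. t \<in> {S..T} \<Longrightarrow> f t \<le> f \<tau>"
    using continuous_attains_sup[of "{S..T}" f] continuous_on_subset[OF cont, of "{S..T}"] by auto
  have "f t0 \<le> f \<tau>" using \<tau>(2)[of t0] \<open>S < t0\<close> \<open>t0 < T\<close> by auto
  then have "f t \<le> f \<tau>" for t
    using \<tau>(2)[of t] S[of t] T[of t] by (cases "t \<le> S"; cases "t \<ge> T") auto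
  then show ?thesis by blast
qed

lemma bounded_if_tendsto_0:
  fixes f :: "real \<Rightarrow> real"
  assumes cont: "continuous_on UNIV f"
    and top: "(f \<longlongrightarrow> 0) at_top" and bot: "(f \<longlongrightarrow> 0) at_bot"
  shows "\<exists>M. \<forall>t. \<bar>f t\<bar> \<le> M"
proof (cases "\<exists>t0. f t0 \<noteq> 0")
  case True
  then obtain t0 where "\<bar>f t0\<bar> > 0" by auto
  then have "\<exists>\<tau>. \<forall>t. \<bar>f t\<bar> \<le> \<bar>f \<tau>\<bar>"
    by (intro attains_max_if_tendsto_0)
      (use cont top bot in \<open>auto intro!: continuous_intros tendsto_rabs_zero\<close>)
  then show ?thesis by blast
qed auto

text \<open>Serves to write a monotone branch of the orbit as a graph over the
  \<open>z\<close>-axis.\<close>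

lemma continuous_inverse_if_decreasing:
  fixes f :: "real \<Rightarrow> real"
  assumes "a \<le> b" and cont: "continuous_on {a..b} f"
    and decr: "\<And>s t. \<lbrakk>a \<le> s; s < t; t \<le> b\<rbrakk> \<Longrightarrow> f t < f s"
  obtains g where "continuous_on {f b..f a} g" "g (f a) = a" "g (f b) = b"
    "\<And>y. \<lbrakk>f b \<le> y; y \<le> f a\<rbrakk> \<Longrightarrow> a \<le> g y \<and> g y \<le> b \<and> f (g y) = y"
proof -
  define g where "g = inv_into {a..b} f"
  have inj: "inj_on f {a..b}"
  proof (rule inj_onI)
    fix s t assume "s \<in> {a..b}" "t \<in> {a..b}" "f s = f t"
    then show "s = t" using decr[of s t] decr[of t s] by (cases s t rule: linorder_cases) auto
  qed
  have g: "g (f t) = t" if "t \<in> {a..b}" for t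
    unfolding g_def using inv_into_f_f[OF inj that] .
  have img: "{f b..f a} \<subseteq> f ` {a..b}"
  proof
    fix y assume "y \<in> {f b..f a}"
    then show "y \<in> f ` {a..b}" using IVT2'[of f b y a] assms(1) cont by auto
  qed
  have "continuous_on (f ` {a..b}) g"
    by (rule continuous_on_inv[OF cont]) (auto simp: g)
  then have "continuous_on {f b..f a} g" using img by (rule continuous_on_subset)
  moreover have "a \<le> g y \<and> g y \<le> b \<and> f (g y) = y" if "f b \<le> y" "y \<le> f a" for y
  proof -
    from that img have "y \<in> f ` {a..b}" by auto
    then show ?thesis using g by auto
  qed
  ultimately show thesis using that[of g] g \<open>a \<le> b\<close> by auto
qed

section \<open>Homoclinic orbits of damped oscillators\<close>

text \<open>The damping \<open>\<alpha> + \<beta> * z\<close> has free coefficients because time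
  reversal combined with \<open>u \<mapsto> - u\<close> negates both. Results about the upper branch
  thus transfer to the lower one.\<close>

locale bt_flow =
  fixes m \<alpha> \<beta> :: real and z u :: "real \<Rightarrow> real"
  assumes m_pos: "m > 0"
    and deriv_z: "\<And>t. (z has_real_derivative - (m * u t)) (at t)"
    and deriv_u: "\<And>t. (u has_real_derivative - (z t * (2 - z t)) + (\<alpha> + \<beta> * z t) * u t) (at t)"
begin

lemma isCont_z: "isCont z t" and isCont_u: "isCont u t"
  using DERIV_isCont deriv_z deriv_u by blast+

lemma continuous_z: "continuous_on S z" and continuous_u: "continuous_on S u"
  by (simp_all add: continuous_at_imp_continuous_on isCont_z isCont_u)

lemma shift: "bt_flow m \<alpha> \<beta> (\<lambda>t. z (t + c)) (\<lambda>t. u (t + c))"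
proof
  show "m > 0" by (rule m_pos)
  fix t
  show "((\<lambda>t. z (t + c)) has_real_derivative - (m * u (t + c))) (at t)"
    using deriv_z[of "t + c"] by (simp add: DERIV_shift)
  show "((\<lambda>t. u (t + c)) has_real_derivative - (z (t + c) * (2 - z (t + c)))
      + (\<alpha> + \<beta> * z (t + c)) * u (t + c)) (at t)"
    using deriv_u[of "t + c"] by (simp add: DERIV_shift)
qed

lemma reflect: "bt_flow m (- \<alpha>) (- \<beta>) (\<lambda>t. z (- t)) (\<lambda>t. - u (- t))"
proof
  show "m > 0" by (rule m_pos)
  fix t
  show "((\<lambda>t. z (- t)) has_real_derivative - (m * - u (- t))) (at t)"
    using deriv_z[of "- t"] by (simp add: DERIV_mirror)
  have "((\<lambda>t. u (- t)) has_real_derivative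
      - (- (z (- t) * (2 - z (- t))) + (\<alpha> + \<beta> * z (- t)) * u (- t))) (at t)"
    using deriv_u[of "- t"] by (simp only: DERIV_mirror)
  from DERIV_minus[OF this]
  show "((\<lambda>t. - u (- t)) has_real_derivative
      - (z (- t) * (2 - z (- t))) + (- \<alpha> + - \<beta> * z (- t)) * - u (- t)) (at t)"
    by (simp add: algebra_simps)
qed

end

text \<open>Gronwall argument for the squared distance \<open>N\<close>, with integrating factor
  \<open>exp (- K * t)\<close> forward and \<open>exp (K * t)\<close> backward. Splitting z1 u1 - z2
  u2 = z1 (u1 - u2) + u2 (z1 - z2) leaves only bounded coefficients.\<close>

lemma bt_flow_unique:
  assumes "bt_flow m \<alpha> \<beta> z1 u1" and "bt_flow m \<alpha> \<beta> z2 u2"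
    and bounds: "\<And>t. \<bar>z1 t\<bar> \<le> M" "\<And>t. \<bar>z2 t\<bar> \<le> M" "\<And>t. \<bar>u2 t\<bar> \<le> M"
    and eq: "z1 s = z2 s" "u1 s = u2 s"
  shows "z1 t = z2 t \<and> u1 t = u2 t"
proof -
  interpret A: bt_flow m \<alpha> \<beta> z1 u1 by fact
  interpret B: bt_flow m \<alpha> \<beta> z2 u2 by fact
  define N where "N = (\<lambda>t. (z1 t - z2 t)\<^sup>2 + (u1 t - u2 t)\<^sup>2)"
  define N' where "N' = (\<lambda>t. 2 * (z1 t - z2 t) * (- (m * u1 t) + m * u2 t)
    + 2 * (u1 t - u2 t) * (- (z1 t * (2 - z1 t)) + (\<alpha> + \<beta> * z1 t) * u1 t
      - (- (z2 t * (2 - z2 t)) + (\<alpha> + \<beta> * z2 t) * u2 t)))"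
  define K1 where "K1 = m + 2 + 2 * M + \<bar>\<beta>\<bar> * M"
  define K2 where "K2 = \<bar>\<alpha>\<bar> + \<bar>\<beta>\<bar> * M"
  define K where "K = K1 + 2 * K2"
  have derN: "(N has_real_derivative N' t) (at t)" for t
    unfolding N_def N'_def
    by (auto intro!: derivative_eq_intros A.deriv_z B.deriv_z A.deriv_u B.deriv_u simp: algebra_simps)
  have "M \<ge> 0" using bounds(1)[of 0] by linarith
  have bound: "\<bar>N' t\<bar> \<le> K * N t" for t
  proof -
    let ?p = "z1 t - z2 t" and ?q = "u1 t - u2 t"
    have N': "N' t = 2 * (?p * ?q) * (- m - 2 + (z1 t + z2 t) + \<beta> * u2 t) + 2 * ?q\<^sup>2 * (\<alpha> + \<beta> * z1 t)"
      unfolding N'_def by (simp add: power2_eq_square algebra_simps)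
    have "\<bar>\<beta> * u2 t\<bar> \<le> \<bar>\<beta>\<bar> * M" "\<bar>\<beta> * z1 t\<bar> \<le> \<bar>\<beta>\<bar> * M"
      using bounds by (simp_all add: abs_mult mult_left_mono)
    then have c: "\<bar>- m - 2 + (z1 t + z2 t) + \<beta> * u2 t\<bar> \<le> K1" "\<bar>\<alpha> + \<beta> * z1 t\<bar> \<le> K2"
      using bounds(1)[of t] bounds(2)[of t] A.m_pos unfolding K1_def K2_def by linarith+
    have pq: "\<bar>2 * (?p * ?q)\<bar> \<le> ?p\<^sup>2 + ?q\<^sup>2"
    proof -
      have "0 \<le> (?p - ?q)\<^sup>2" "0 \<le> (?p + ?q)\<^sup>2" by simp_all
      then show ?thesis by (simp add: power2_eq_square algebra_simps abs_le_iff)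
    qed
    have "\<bar>N' t\<bar> \<le> \<bar>2 * (?p * ?q)\<bar> * \<bar>- m - 2 + (z1 t + z2 t) + \<beta> * u2 t\<bar> + 2 * ?q\<^sup>2 * \<bar>\<alpha> + \<beta> * z1 t\<bar>"
      unfolding N' by (rule order_trans[OF abs_triangle_ineq]) (simp add: abs_mult)
    also have "\<dots> \<le> (?p\<^sup>2 + ?q\<^sup>2) * K1 + 2 * (?p\<^sup>2 + ?q\<^sup>2) * K2"
      by (intro add_mono mult_mono pq c) auto
    finally show ?thesis by (simp add: N_def K_def algebra_simps)
  qed
  have Ns: "N s = 0" using eq by (simp add: N_def)
  have "N t \<le> 0"
  proof (cases "s \<le> t")
    case True
    have "N t * exp (- K * t) \<le> N s * exp (- K * s)"
    proof (rule DERIV_nonpos_imp_nonincreasing[OF True])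
      fix r
      have "((\<lambda>t. N t * exp (- K * t)) has_real_derivative (N' r - K * N r) * exp (- K * r)) (at r)"
        by (rule derivative_eq_intros derN refl | simp add: algebra_simps)+
      moreover have "(N' r - K * N r) * exp (- K * r) \<le> 0"
        using bound[of r] by (intro mult_nonpos_nonneg) auto
      ultimately show "\<exists>y. ((\<lambda>t. N t * exp (- K * t)) has_real_derivative y) (at r) \<and> y \<le> 0" by blast
    qed
    then show ?thesis by (simp add: Ns mult_le_0_iff)
  next
    case False
    then have "N t * exp (K * t) \<le> N s * exp (K * s)"
    proof (intro DERIV_nonneg_imp_nondecreasing[of t s "\<lambda>t. N t * exp (K * t)"])
      fix r
      have "((\<lambda>t. N t * exp (K * t)) has_real_derivative (N' r + K * N r) * exp (K * r)) (at r)"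
        by (rule derivative_eq_intros derN refl | simp add: algebra_simps)+
      moreover have "(N' r + K * N r) * exp (K * r) \<ge> 0"
        using bound[of r] by (intro mult_nonneg_nonneg) auto
      ultimately show "\<exists>y. ((\<lambda>t. N t * exp (K * t)) has_real_derivative y) (at r) \<and> y \<ge> 0" by blast
    qed auto
    then show ?thesis by (simp add: Ns mult_le_0_iff)
  qed
  moreover have "N t \<ge> 0" by (simp add: N_def)
  ultimately have "N t = 0" by simp
  then show ?thesis by (simp add: N_def sum_power2_eq_zero_iff)
qed

section \<open>Shape of homoclinic orbits\<close>

locale bt_homoclinic = bt_flow +
  assumes z_top: "(z \<longlongrightarrow> 0) at_top" and z_bot: "(z \<longlongrightarrow> 0) at_bot"
    and u_top: "(u \<longlongrightarrow> 0) at_top" and u_bot: "(u \<longlongrightarrow> 0) at_bot"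
    and nontrivial: "\<exists>t. z t \<noteq> 0 \<or> u t \<noteq> 0"
begin

lemma reflect_homoclinic: "bt_homoclinic m (- \<alpha>) (- \<beta>) (\<lambda>t. z (- t)) (\<lambda>t. - u (- t))"
proof (intro bt_homoclinic.intro bt_homoclinic_axioms.intro)
  show "bt_flow m (- \<alpha>) (- \<beta>) (\<lambda>t. z (- t)) (\<lambda>t. - u (- t))" by (rule reflect)
  show "((\<lambda>t. z (- t)) \<longlongrightarrow> 0) at_top" "((\<lambda>t. z (- t)) \<longlongrightarrow> 0) at_bot"
    using z_top z_bot by (simp add: filterlim_at_top_mirror, simp add: filterlim_at_bot_mirror)
  have "((\<lambda>t. u (- t)) \<longlongrightarrow> 0) at_top" "((\<lambda>t. u (- t)) \<longlongrightarrow> 0) at_bot"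
    using u_top u_bot by (simp add: filterlim_at_top_mirror, simp add: filterlim_at_bot_mirror)
  from this[THEN tendsto_minus]
  show "((\<lambda>t. - u (- t)) \<longlongrightarrow> 0) at_top" "((\<lambda>t. - u (- t)) \<longlongrightarrow> 0) at_bot"
    by simp_all
  obtain t where "z t \<noteq> 0 \<or> u t \<noteq> 0" using nontrivial by blast
  then have "z (- (- t)) \<noteq> 0 \<or> - u (- (- t)) \<noteq> 0" by simp
  then show "\<exists>t. z (- t) \<noteq> 0 \<or> - u (- t) \<noteq> 0" by blast
qed

lemma bounded: "\<exists>M. \<forall>t. \<bar>z t\<bar> \<le> M \<and> \<bar>u t\<bar> \<le> M"
proof -
  obtain M1 M2 where "\<And>t. \<bar>z t\<bar> \<le> M1" "\<And>t. \<bar>u t\<bar> \<le> M2"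
    using bounded_if_tendsto_0[OF continuous_z z_top z_bot]
      bounded_if_tendsto_0[OF continuous_u u_top u_bot] by blast
  then have "\<bar>z t\<bar> \<le> max M1 M2 \<and> \<bar>u t\<bar> \<le> max M1 M2" for t by (simp add: max.coboundedI1 max.coboundedI2)
  then show ?thesis by blast
qed

lemma nonzero: "z t \<noteq> 0 \<or> u t \<noteq> 0"
proof (rule ccontr)
  assume *: "\<not> (z t \<noteq> 0 \<or> u t \<noteq> 0)"
  obtain M where M: "\<And>t. \<bar>z t\<bar> \<le> M \<and> \<bar>u t\<bar> \<le> M" using bounded by blast
  have "0 \<le> M" using M[of 0] by linarith
  have zero: "bt_flow m \<alpha> \<beta> (\<lambda>t. 0) (\<lambda>t. 0)"
    using m_pos by unfold_locales auto
  have "z r = 0 \<and> u r = 0" for r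
    using bt_flow_unique[OF bt_flow_axioms zero, of M t r] M \<open>0 \<le> M\<close> * by simp
  then show False using nontrivial by simp
qed

text \<open>A repeated point makes the orbit periodic by uniqueness; being constant along
  \<open>t + n c\<close> while tending to 0, it would be trivial.\<close>

lemma orbit_injective:
  assumes "s < r"
  shows "z s \<noteq> z r \<or> u s \<noteq> u r"
proof (rule ccontr)
  assume eq: "\<not> (z s \<noteq> z r \<or> u s \<noteq> u r)"
  define c where "c = r - s"
  have "c > 0" using \<open>s < r\<close> by (simp add: c_def)
  obtain M where M: "\<And>t. \<bar>z t\<bar> \<le> M \<and> \<bar>u t\<bar> \<le> M" using bounded by blast
  have per: "z (t + c) = z t \<and> u (t + c) = u t" for t
    by (rule bt_flow_unique[OF shift[of c] bt_flow_axioms, of M s]) (use M eq in \<open>simp_all add: c_def\<close>)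
  have mult: "z (t + real n * c) = z t \<and> u (t + real n * c) = u t" for n t
  proof (induction n)
    case (Suc n)
    then show ?case using per[of "t + real n * c"] by (simp add: algebra_simps)
  qed auto
  have lim: "filterlim (\<lambda>n. t + real n * c) at_top sequentially" for t
  proof -
    have "filterlim (\<lambda>n. real n * c) at_top sequentially"
      using filterlim_tendsto_pos_mult_at_top[OF tendsto_const \<open>c > 0\<close> filterlim_real_sequentially]
      by (simp add: mult.commute)
    then show ?thesis by (rule filterlim_tendsto_add_at_top[OF tendsto_const])
  qed
  have "z t = 0 \<and> u t = 0" for t
    using filterlim_compose[OF z_top lim[of t]] filterlim_compose[OF u_top lim[of t]]
    by (simp add: mult LIMSEQ_const_iff)
  then show False using nontrivial by simp
qed

text \<open>The quadrant \<open>z \<le> 0\<close>, \<open>u > 0\<close> traps the orbit: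
  \<open>z\<close> decreases there, and \<open>u\<close> cannot return to 0 since its derivative
  would be positive. Then \<open>z\<close> moves away from its limit 0.\<close>

lemma z_pos_if_u_pos:
  assumes "u t0 > 0"
  shows "z t0 > 0"
proof (rule ccontr)
  assume neg: "\<not> z t0 > 0"
  have z_decr: "z s < z t0" if "t0 < s" "\<And>r. \<lbrakk>t0 \<le> r; r < s\<rbrakk> \<Longrightarrow> u r > 0" for s
  proof -
    have "- z t0 < - z s"
      by (rule less_if_deriv_pos[OF that(1), of "\<lambda>t. - z t" "\<lambda>t. m * u t"])
        (use that m_pos DERIV_minus[OF deriv_z] in auto)
    then show ?thesis by simp
  qed
  have u_pos: "u t > 0" if "t0 \<le> t" for t
  proof (rule ccontr)
    assume "\<not> u t > 0"
    then have "u t \<le> 0" "t0 < t" using that assms by (cases "t = t0"; simp)+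
    then obtain c where c: "t0 < c" "u c = 0" "\<And>t. \<lbrakk>t0 \<le> t; t < c\<rbrakk> \<Longrightarrow> u t > 0"
      "\<And>D. (u has_real_derivative D) (at c) \<Longrightarrow> D \<le> 0"
      by (rule first_zero[OF isCont_u assms]) blast+
    have "z c < 0" using z_decr[OF c(1,3)] neg by simp
    then have "z c * (2 - z c) < 0" by (simp add: mult_neg_pos)
    then show False using c(4)[OF deriv_u] c(2) by simp
  qed
  have "- z t \<ge> - z (t0 + 1)" if "t0 + 1 \<le> t" for t
  proof (cases "t = t0 + 1")
    case False
    have "- z (t0 + 1) < - z t"
      by (rule less_if_deriv_pos[of "t0 + 1" t "\<lambda>t. - z t" "\<lambda>t. m * u t"])
        (use that False m_pos u_pos DERIV_minus[OF deriv_z] in auto)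
    then show ?thesis by simp
  qed auto
  then have "- 0 \<ge> - z (t0 + 1)"
    by (intro tendsto_at_top_ge_of_ge[OF tendsto_minus[OF z_top]])
  then show False using z_decr[of "t0 + 1"] u_pos neg by simp
qed

lemma z_pos: "z t > 0"
proof -
  consider "u t > 0" | "u t < 0" | "u t = 0" by linarith
  then show ?thesis
  proof cases
    case 1
    then show ?thesis by (rule z_pos_if_u_pos)
  next
    case 2
    then show ?thesis using bt_homoclinic.z_pos_if_u_pos[OF reflect_homoclinic, of "- t"] by simp
  next
    case 3
    show ?thesis
    proof (rule ccontr)
      assume "\<not> z t > 0"
      then have "z t < 0" using nonzero[of t] 3 by simp
      then have "- (z t * (2 - z t)) + (\<alpha> + \<beta> * z t) * u t > 0"
        using 3 by (simp add: mult_neg_pos)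
      from DERIV_pos_inc_right[OF deriv_u this]
      obtain d where d: "d > 0" "\<And>h. \<lbrakk>0 < h; h < d\<rbrakk> \<Longrightarrow> u t < u (t + h)" by blast
      have "\<forall>\<^sub>F s in at t. z s < 0"
        using order_tendstoD(2)[of z "z t" "at t" 0] isCont_z[of t] \<open>z t < 0\<close> by (simp add: isCont_def)
      then obtain e where e: "e > 0" "\<And>s. \<lbrakk>s \<noteq> t; dist s t < e\<rbrakk> \<Longrightarrow> z s < 0"
        by (auto simp: eventually_at)
      define h where "h = min d e / 2"
      have h: "0 < h" "h < d" "h < e" using d e by (auto simp: h_def)
      then have "u (t + h) > 0" using d(2)[of h] 3 by simp
      moreover have "z (t + h) < 0" using e(2)[of "t + h"] h by (simp add: dist_real_def)
      ultimately show False using z_pos_if_u_pos[of "t + h"] by simp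
    qed
  qed
qed

lemma z_less_if_u_pos:
  assumes "s < t" "\<And>r. \<lbrakk>s < r; r < t\<rbrakk> \<Longrightarrow> u r > 0"
  shows "z t < z s"
proof -
  have "- z s < - z t"
    by (rule less_if_deriv_pos[OF assms(1), of "\<lambda>t. - z t" "\<lambda>t. m * u t"])
      (use assms m_pos DERIV_minus[OF deriv_z] in auto)
  then show ?thesis by simp
qed

lemma z_less_if_u_neg:
  assumes "s < t" "\<And>r. \<lbrakk>s < r; r < t\<rbrakk> \<Longrightarrow> u r < 0"
  shows "z s < z t"
  by (rule less_if_deriv_pos[OF assms(1), of z "\<lambda>t. - (m * u t)"])
    (use assms m_pos deriv_z in \<open>auto simp: mult_pos_neg\<close>)

text \<open>Once \<open>z < 2\<close>, the axis \<open>u = 0\<close> is crossed only downwards. A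
  nonpositive \<open>u\<close> would then stay negative, and \<open>z\<close> would increase instead
  of tending to 0.\<close>

lemma u_eventually_pos: "\<exists>T. \<forall>t\<ge>T. u t > 0"
proof -
  obtain T where T: "\<And>t. t \<ge> T \<Longrightarrow> z t < 2"
    using order_tendstoD(2)[OF z_top, of 2] by (auto simp: eventually_at_top_linorder)
  have "u t1 > 0" if "T \<le> t1" for t1
  proof (rule ccontr)
    assume "\<not> u t1 > 0"
    have neg: "u t < 0" if "t1 < t" for t
    proof -
      have "- u t > 0"
      proof (rule pos_after_if_deriv_pos_at_zeros[OF DERIV_minus[OF deriv_u] _ _ that])
        show "0 \<le> - u t1" using \<open>\<not> u t1 > 0\<close> by simp
        fix r assume "t1 \<le> r" "- u r = 0"
        then show "0 < - (- (z r * (2 - z r)) + (\<alpha> + \<beta> * z r) * u r)"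
          using T[of r] z_pos[of r] \<open>T \<le> t1\<close> by simp
      qed
      then show ?thesis by simp
    qed
    have "z t \<ge> z t1" if "t1 \<le> t" for t
      using z_less_if_u_neg[of t1 t] neg that by (cases "t = t1") auto
    then have "0 \<ge> z t1" by (rule tendsto_at_top_ge_of_ge[OF z_top])
    then show False using z_pos[of t1] by simp
  qed
  then show ?thesis by blast
qed

text \<open>If the orbit turned back after its extreme point, its last branch over the \<open>z\<close>-axis and
  the first one would cross, since they are ordered oppositely at the two ends of their common range;
  but the orbit is injective.\<close>
lemma u_pos_after_max:
  assumes max: "\<And>t. z t \<le> z \<tau>" and "z \<tau> > 2" and "u \<tau> = 0"
    and no_focus: "\<And>t. \<not> (z t = 2 \<and> u t = 0)"
    and "\<tau> < t"
  shows "u t > 0"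
proof (rule ccontr)
  assume neg: "\<not> u t > 0"
  have "z \<tau> * (2 - z \<tau>) < 0" using \<open>z \<tau> > 2\<close> by (simp add: mult_pos_neg)
  then have "- (z \<tau> * (2 - z \<tau>)) + (\<alpha> + \<beta> * z \<tau>) * u \<tau> > 0"
    using \<open>u \<tau> = 0\<close> by simp
  from DERIV_pos_inc_right[OF deriv_u this]
  obtain d where d: "d > 0" "\<And>h. \<lbrakk>0 < h; h < d\<rbrakk> \<Longrightarrow> u \<tau> < u (\<tau> + h)" by blast
  have near: "u r > 0" if "\<tau> < r" "r < \<tau> + d" for r
    using d(2)[of "r - \<tau>"] that \<open>u \<tau> = 0\<close> by simp
  define s0 where "s0 = \<tau> + min d (t - \<tau>) / 2"
  have s0: "\<tau> < s0" "s0 < \<tau> + d" "s0 < t" using d \<open>\<tau> < t\<close> by (auto simp: s0_def min_def field_simps)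
  obtain c1 where c1: "s0 < c1" "u c1 = 0" "\<And>t. \<lbrakk>s0 \<le> t; t < c1\<rbrakk> \<Longrightarrow> u t > 0"
    "\<And>D. (u has_real_derivative D) (at c1) \<Longrightarrow> D \<le> 0"
    by (rule first_zero[OF isCont_u near[OF s0(1,2)] _ s0(3)]) (use neg in \<open>auto simp: not_less\<close>)
  have leg1: "u r > 0" if "\<tau> < r" "r < c1" for r
    using near[of r] c1(3)[of r] that s0 by (cases "r < s0") auto
  \<comment> \<open>The direction of crossing tells the side of the focus \<open>z = 2\<close>: the
    first downward crossing \<open>c1\<close> has \<open>z < 2\<close>, the last upward crossing
    \<open>c2\<close> has \<open>z > 2\<close>.\<close>
  have "z c1 * (2 - z c1) \<ge> 0" using c1(4)[OF deriv_u] c1(2) by simp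
  then have zc1: "z c1 < 2" using z_pos[of c1] no_focus[of c1] c1(2)
    by (simp add: zero_le_mult_iff)
  obtain T where T: "\<And>t. t \<ge> T \<Longrightarrow> u t > 0" using u_eventually_pos by blast
  define T1 where "T1 = max T c1 + 1"
  have T1: "u T1 > 0" "c1 < T1" "\<And>t. t \<ge> T1 \<Longrightarrow> u t > 0" using T by (auto simp: T1_def)
  obtain c2 where c2: "c1 \<le> c2" "c2 < T1" "u c2 = 0" "\<And>t. \<lbrakk>c2 < t; t \<le> T1\<rbrakk> \<Longrightarrow> u t > 0"
    "\<And>D. (u has_real_derivative D) (at c2) \<Longrightarrow> D \<ge> 0"
    by (rule last_zero[OF isCont_u T1(1) _ T1(2)]) (use c1 in auto)
  have leg2: "u r > 0" if "c2 < r" for r using c2(4)[of r] T1(3)[of r] that by (cases "r \<le> T1") auto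
  have "z c2 * (2 - z c2) \<le> 0" using c2(5)[OF deriv_u] c2(3) by simp
  then have zc2: "z c2 > 2" using z_pos[of c2] no_focus[of c2] c2(3)
    by (simp add: mult_le_0_iff)
  have "c1 < c2" using c2(1) zc1 zc2 by (cases "c1 = c2") auto
  obtain T2 where T2: "\<And>t. t \<ge> T2 \<Longrightarrow> z t < z c1"
    using order_tendstoD(2)[OF z_top z_pos[of c1]] by (auto simp: eventually_at_top_linorder)
  obtain T' where T': "c2 \<le> T'" "z T' = z c1"
    using IVT2'[of z "max T2 c2" "z c1" c2] T2[of "max T2 c2"] zc1 zc2 continuous_z by force
  then have "c2 < T'" using zc1 zc2 by (cases "c2 = T'") auto
  have "\<tau> \<le> c1" using s0 c1 by simp
  have decr1: "z t < z s" if "\<tau> \<le> s" "s < t" "t \<le> c1" for s t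
    using z_less_if_u_pos[OF that(2)] leg1 that by simp
  have decr2: "z t < z s" if "c2 \<le> s" "s < t" for s t
    using z_less_if_u_pos[OF that(2)] leg2 that by simp
  obtain g1 where g1: "continuous_on {z c1..z \<tau>} g1" "g1 (z \<tau>) = \<tau>" "g1 (z c1) = c1"
    "\<And>y. \<lbrakk>z c1 \<le> y; y \<le> z \<tau>\<rbrakk> \<Longrightarrow> \<tau> \<le> g1 y \<and> g1 y \<le> c1 \<and> z (g1 y) = y"
    by (rule continuous_inverse_if_decreasing[OF \<open>\<tau> \<le> c1\<close> continuous_z decr1]) blast+
  obtain g2 where g2: "continuous_on {z T'..z c2} g2" "g2 (z c2) = c2" "g2 (z T') = T'"
    "\<And>y. \<lbrakk>z T' \<le> y; y \<le> z c2\<rbrakk> \<Longrightarrow> c2 \<le> g2 y \<and> g2 y \<le> T' \<and> z (g2 y) = y"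
    by (rule continuous_inverse_if_decreasing[OF T'(1) continuous_z decr2]) blast+
  have sub: "{z c1..z c2} \<subseteq> {z c1..z \<tau>}" using max[of c2] by auto
  have cont: "continuous_on {z c1..z c2} (\<lambda>y. u (g1 y) - u (g2 y))"
    using continuous_on_compose2[OF continuous_u continuous_on_subset[OF g1(1) sub]]
      continuous_on_compose2[OF continuous_u g2(1)] T'(2)
    by (auto intro!: continuous_on_diff)
  have "g1 (z c2) \<ge> \<tau>" "g1 (z c2) \<le> c1" using g1(4)[of "z c2"] max[of c2] zc1 zc2 by auto
  then have "u (g1 (z c2)) \<ge> 0"
    using leg1[of "g1 (z c2)"] \<open>u \<tau> = 0\<close> c1(2)
    by (cases "g1 (z c2) = \<tau>"; cases "g1 (z c2) = c1") auto
  \<comment> \<open>Over \<open>z c1\<close> the first branch is on the axis and the last one above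
    it; over \<open>z c2\<close> the last one is on the axis and the first one not below it. They
    meet over some \<open>y\<close>, at distinct times because \<open>c1 < c2\<close>.\<close>
  then obtain y where y: "z c1 \<le> y" "y \<le> z c2" "u (g1 y) - u (g2 y) = 0"
    using IVT'[of "\<lambda>y. u (g1 y) - u (g2 y)" "z c1" 0 "z c2", OF _ _ _ cont]
      g1(3) g2(2,3) T'(2) c1(2) c2(3) leg2[OF \<open>c2 < T'\<close>] zc1 zc2 by auto
  have "g1 y < g2 y" "z (g1 y) = z (g2 y)"
    using g1(4)[of y] g2(4)[of y] y T'(2) max[of c2] \<open>c1 < c2\<close> by auto
  then show False using orbit_injective[of "g1 y" "g2 y"] y(3) by simp
qed

lemma u_neg_before_max:
  assumes "\<And>t. z t \<le> z \<tau>" and "z \<tau> > 2" and "u \<tau> = 0"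
    and "\<And>t. \<not> (z t = 2 \<and> u t = 0)"
    and "t < \<tau>"
  shows "u t < 0"
  using bt_homoclinic.u_pos_after_max[OF reflect_homoclinic, of "- \<tau>" "- t"] assms by simp

end

section \<open>Barriers\<close>

locale bt_saddle_loop = bt_homoclinic m "m * a" "- m" z u for m a z u +
  fixes \<tau> :: real
  assumes u_turn: "u \<tau> = 0"
    and u_after: "\<And>t. \<tau> < t \<Longrightarrow> u t > 0"
    and u_before: "\<And>t. t < \<tau> \<Longrightarrow> u t < 0"
begin

section \<open>Monotone branches and first estimates for them\<close>

lemma z_less_after: "\<lbrakk>\<tau> \<le> s; s < t\<rbrakk> \<Longrightarrow> z t < z s"
  by (rule z_less_if_u_pos) (auto intro: u_after)

lemma z_less_before: "\<lbrakk>s < t; t \<le> \<tau>\<rbrakk> \<Longrightarrow> z s < z t"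
  by (rule z_less_if_u_neg) (auto intro: u_before)

lemma obtain_after:
  assumes "0 < y" "y < z \<tau>"
  obtains t where "\<tau> < t" "z t = y"
proof -
  obtain T where T: "\<And>t. t \<ge> T \<Longrightarrow> z t < y"
    using order_tendstoD(2)[OF z_top assms(1)] by (auto simp: eventually_at_top_linorder)
  obtain t where "\<tau> \<le> t" "z t = y"
    using IVT2'[of z "max T \<tau>" y \<tau>] T[of "max T \<tau>"] assms continuous_z by force
  then show thesis using that[of t] assms by (cases "t = \<tau>") auto
qed

lemma obtain_before:
  assumes "0 < y" "y < z \<tau>"
  obtains t where "t < \<tau>" "z t = y"
proof -
  obtain T where T: "\<And>t. t \<le> T \<Longrightarrow> z t < y"
    using order_tendstoD(2)[OF z_bot assms(1)] by (auto simp: eventually_at_bot_linorder)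
  obtain t where "t \<le> \<tau>" "z t = y"
    using IVT'[of z "min T \<tau>" y \<tau>] T[of "min T \<tau>"] assms continuous_z by force
  then show thesis using that[of t] assms by (cases "t = \<tau>") auto
qed

text \<open>The parabola is the orbit through the saddle when the restoring term
  \<open>z * (2 - z)\<close> is dropped and \<open>a\<close> is replaced by \<open>a0\<close>. For
  \<open>z < 2\<close> this term pushes the lower branch further down.\<close>

lemma lower_branch_gt:
  assumes "t0 \<le> \<tau>" "z t0 \<le> 2" "a0 \<le> a"
  shows "a0 * z t0 - (z t0)\<^sup>2 / 2 < - u t0"
proof -
  define f where "f = (\<lambda>t. - u t - (a0 * z t - (z t)\<^sup>2 / 2))"
  define f' where "f' = (\<lambda>t. z t * (2 - z t) - m * (a - a0) * u t)"
  have der: "(f has_real_derivative f' t) (at t)" for t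
    unfolding f_def f'_def
    by (auto intro!: derivative_eq_intros deriv_z deriv_u simp: algebra_simps power2_eq_square)
  have f_less: "f s < f t" if "s < t" "t \<le> t0" for s t
  proof (rule less_if_deriv_pos[OF that(1) der])
    fix r assume "s < r" "r < t"
    then have "z r < z t0" "u r < 0" using z_less_before[of r t0] u_before[of r] that assms by auto
    then have "z r * (2 - z r) > 0" "m * (a - a0) * u r \<le> 0" using z_pos[of r] assms m_pos
      by (auto intro!: mult_pos_pos mult_nonneg_nonpos)
    then show "f' r > 0" by (simp add: f'_def)
  qed
  have "(f \<longlongrightarrow> - 0 - (a0 * 0 - 0\<^sup>2 / 2)) at_bot"
    unfolding f_def by (intro tendsto_intros z_bot u_bot) auto
  then have "((\<lambda>t. - f t) \<longlongrightarrow> 0) at_bot" using tendsto_minus by fastforce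
  \<comment> \<open>The limit at minus infinity only gives \<open>f (t0 - 1) \<ge> 0\<close>; the
    remaining unit of time makes the inequality strict.\<close>
  moreover have "- f t \<ge> - f (t0 - 1)" if "t \<le> t0 - 1" for t
    using f_less[of t "t0 - 1"] that by (cases "t = t0 - 1") auto
  ultimately have "0 \<ge> - f (t0 - 1)" by (rule tendsto_at_bot_ge_of_ge)
  then show ?thesis using f_less[of "t0 - 1" t0] by (simp add: f_def)
qed

text \<open>Above a sufficiently steep line the excess \<open>f\<close> decreases in time, so a
  positive excess would stay bounded away from 0 in the past. The bound serves to make
  \<open>u\<^sup>2 / z\<close> tend to 0 at the saddle.\<close>

lemma lower_branch_le_linear: "\<exists>C\<ge>0. \<forall>t\<le>\<tau>. - u t \<le> C * z t"
proof -
  define C where "C = \<bar>a\<bar> + (1 + 2 / m)"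
  have C: "C \<ge> 1" "m * (C - \<bar>a\<bar>) \<ge> 2" using m_pos by (auto simp: C_def field_simps)
  define f where "f = (\<lambda>t. - u t - C * z t)"
  define f' where "f' = (\<lambda>t. z t * (2 - z t) - m * (a - z t - C) * u t)"
  have der: "(f has_real_derivative f' t) (at t)" for t
    unfolding f_def f'_def
    by (auto intro!: derivative_eq_intros deriv_z deriv_u simp: algebra_simps)
  have f'_neg: "f' t < 0" if "f t \<ge> 0" for t
  proof -
    have w: "- u t \<ge> z t" "- u t > 0"
      using that C mult_right_mono[OF C(1), of "z t"] z_pos[of t] unfolding f_def by linarith+
    have "a - z t - C \<le> - (C - \<bar>a\<bar>)" using z_pos[of t] by simp
    then have "m * (a - z t - C) \<le> m * - (C - \<bar>a\<bar>)" using m_pos by (intro mult_left_mono) auto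
    then have "m * (a - z t - C) \<le> - 2" using C(2) by linarith
    then have "m * (a - z t - C) * (- u t) \<le> - 2 * (- u t)" using w by (intro mult_right_mono) auto
    moreover have "z t * (2 - z t) < 2 * z t" using z_pos[of t] by (simp add: algebra_simps)
    ultimately show ?thesis using w unfolding f'_def by linarith
  qed
  have "f t1 \<le> 0" for t1
  proof (rule ccontr)
    assume *: "\<not> f t1 \<le> 0"
    have pos: "f t > 0" if "t < t1" for t
      by (rule pos_before_if_deriv_neg_at_zeros[OF der _ _ that]) (use * f'_neg in auto)
    have "f t \<ge> f t1" if "t \<le> t1" for t
    proof (cases "t = t1")
      case False
      have "- f t < - f t1"
        by (rule less_if_deriv_pos[of t t1 "\<lambda>t. - f t" "\<lambda>t. - f' t"])
          (use that False pos f'_neg DERIV_minus[OF der] in \<open>auto intro: less_imp_le\<close>)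
      then show ?thesis by simp
    qed auto
    moreover have "(f \<longlongrightarrow> - 0 - C * 0) at_bot"
      unfolding f_def by (intro tendsto_intros z_bot u_bot)
    ultimately have "- 0 - C * 0 \<ge> f t1" by (rule tendsto_at_bot_ge_of_ge[rotated])
    then show False using * by simp
  qed
  then show ?thesis using C by (intro exI[of _ C]) (auto simp: f_def)
qed

text \<open>Since \<open>x + y = m\<close> is invariant for \<open>b = m - 1\<close>, the orbit cannot reach the saddle from above
  when \<open>b \<le> m - 1\<close>; here \<open>m * a = b + m\<close>.\<close>
lemma line_barrier: "m * a > 2 * m - 1"
proof (rule ccontr)
  assume "\<not> m * a > 2 * m - 1"
  then have ma: "2 * m - 1 - m * a \<ge> 0" by simp
  have "m \<noteq> 0" using m_pos by simp
  define f where "f = (\<lambda>t. z t / m - u t)"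
  define f' where "f' = (\<lambda>t. m * (2 - z t) * f t + u t * (2 * m - 1 - m * a))"
  have der: "(f has_real_derivative f' t) (at t)" for t
    unfolding f_def f'_def using \<open>m \<noteq> 0\<close>
    by (auto intro!: derivative_eq_intros deriv_z deriv_u simp: field_simps)
  \<comment> \<open>The term \<open>u * (2 * m - 1 - m * a)\<close> may vanish, so \<open>f\<close>
    is compared with a decaying exponential \<open>e\<close> that starts at half of
    \<open>f \<tau>\<close>. Its rate \<open>C\<close> keeps \<open>m * (2 - z) + C\<close> positive
    on the whole upper branch.\<close>
  define C where "C = m * z \<tau>"
  define e where "e = (\<lambda>t. z \<tau> / (2 * m) * exp (- C * (t - \<tau>)))"
  have e_pos: "e t > 0" for t using z_pos[of \<tau>] m_pos by (simp add: e_def)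
  have der_e: "(e has_real_derivative - C * e t) (at t)" for t
    unfolding e_def using \<open>m \<noteq> 0\<close> by (auto intro!: derivative_eq_intros)
  have f_pos: "f t > 0" if "\<tau> < t" for t
  proof -
    have "f t - e t > 0"
    proof (rule pos_after_if_deriv_pos_at_zeros[OF DERIV_diff[OF der der_e] _ _ that])
      show "0 \<le> f \<tau> - e \<tau>" using z_pos[of \<tau>] m_pos by (simp add: f_def e_def u_turn field_simps)
      fix r assume r: "\<tau> \<le> r" "f r - e r = 0"
      have "z r \<le> z \<tau>" "u r \<ge> 0"
        using z_less_after[of \<tau> r] u_after[of r] u_turn r by (cases "r = \<tau>"; simp)+
      then have "m * (2 - z r) + C > 0" using m_pos
        unfolding C_def by (simp add: algebra_simps) (smt (verit) mult_left_mono)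
      then have "(m * (2 - z r) + C) * e r > 0" using e_pos by simp
      moreover have "u r * (2 * m - 1 - m * a) \<ge> 0" using \<open>u r \<ge> 0\<close> ma by simp
      moreover have "f' r - - C * e r = (m * (2 - z r) + C) * e r + u r * (2 * m - 1 - m * a)"
        using r by (simp add: f'_def algebra_simps)
      ultimately show "0 < f' r - - C * e r" by linarith
    qed
    then show ?thesis using e_pos[of t] by simp
  qed
  obtain T where T: "\<And>t. t \<ge> T \<Longrightarrow> z t < 2"
    using order_tendstoD(2)[OF z_top, of 2] by (auto simp: eventually_at_top_linorder)
  define S where "S = max T \<tau> + 1"
  have "f t \<ge> f S" if "S \<le> t" for t
  proof (cases "S = t")
    case False
    have "f S < f t"
    proof (rule less_if_deriv_pos[OF _ der])
      show "S < t" using that False by simp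
      fix r assume "S < r" "r < t"
      then have "f r > 0" "z r < 2" "u r > 0" using f_pos[of r] T[of r] u_after[of r] by (auto simp: S_def)
      then have "m * (2 - z r) * f r > 0" "u r * (2 * m - 1 - m * a) \<ge> 0"
        using m_pos ma by simp_all
      then show "f' r > 0" by (simp add: f'_def)
    qed
    then show ?thesis by simp
  qed auto
  moreover have "(f \<longlongrightarrow> 0 / m - 0) at_top"
    unfolding f_def using m_pos by (intro tendsto_intros z_top u_top) auto
  ultimately have "0 / m - 0 \<ge> f S" by (rule tendsto_at_top_ge_of_ge[rotated])
  moreover have "\<tau> < S" unfolding S_def by linarith
  ultimately show False using f_pos[of S] by simp
qed

end

text \<open>The curve \<open>m u\<^sup>2 + 2 m B(z) u = A(z)\<close>, with \<open>A\<close> determined by \<open>B\<close> through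
  \<open>A' = 2 z (2 - z) + 2 m B (k - z - 2 B')\<close>, is crossed by the flow of parameter \<open>a = k\<close>
  in a direction given by the sign of the remainder \<open>R = A (B' - k + z) + B z (2 - z)\<close> alone.\<close>

definition curveB :: "real \<Rightarrow> real \<Rightarrow> real \<Rightarrow> real" where
  "curveB p q z = p * z + q * z\<^sup>2"

definition curveA :: "real \<Rightarrow> real \<Rightarrow> real \<Rightarrow> real \<Rightarrow> real \<Rightarrow> real" where
  "curveA m k p q z = z\<^sup>2 * (2 + m * p * (k - 2 * p)
     + 2 * (m * (q * (k - 2 * p) - p * (1 + 4 * q)) - 1) / 3 * z - m * q * (1 + 4 * q) / 2 * z\<^sup>2)"

definition curveR :: "real \<Rightarrow> real \<Rightarrow> real \<Rightarrow> real \<Rightarrow> real \<Rightarrow> real" where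
  "curveR m k p q z = curveA m k p q z * (p - k + (2 * q + 1) * z) + curveB p q z * (z * (2 - z))"

section \<open>The curves quadratic in \<open>u\<close> as barriers\<close>

lemma deriv_curveA:
  "(curveA m k p q has_real_derivative
     2 * (z * (2 - z)) + 2 * m * curveB p q z * (k - z - 2 * (p + 2 * q * z))) (at z)"
  unfolding curveA_def[abs_def] curveB_def
  by (auto intro!: derivative_eq_intros simp: field_simps power2_eq_square)

lemma deriv_curveB: "(curveB p q has_real_derivative p + 2 * q * z) (at z)"
  unfolding curveB_def[abs_def]
  by (auto intro!: derivative_eq_intros)

context bt_saddle_loop
begin

context
  fixes k p q :: real
begin

definition "curveF t = m * (u t)\<^sup>2 + 2 * m * curveB p q (z t) * u t - curveA m k p q (z t)"

definition "curveF' t = 2 * m * (k - z t - p - 2 * q * z t) * curveF t - 2 * m * curveR m k p q (z t)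
  + 2 * m\<^sup>2 * (a - k) * (u t * (u t + curveB p q (z t)))"

lemma deriv_curveF: "(curveF has_real_derivative curveF' t) (at t)"
proof -
  have A: "((\<lambda>t. curveA m k p q (z t)) has_real_derivative
      (2 * (z t * (2 - z t)) + 2 * m * curveB p q (z t) * (k - z t - 2 * (p + 2 * q * z t)))
      * - (m * u t)) (at t)"
    by (rule DERIV_chain2[OF deriv_curveA deriv_z])
  have B: "((\<lambda>t. curveB p q (z t)) has_real_derivative (p + 2 * q * z t) * - (m * u t)) (at t)"
    by (rule DERIV_chain2[OF deriv_curveB deriv_z])
  show ?thesis
    unfolding curveF_def[abs_def]
    by (rule derivative_eq_intros deriv_u A B refl)+
      (simp add: curveF'_def curveF_def curveR_def power2_eq_square algebra_simps)
qed

text \<open>The product of \<open>u\<close> and \<open>curveB\<close> is eliminated through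
  \<open>curveF\<close>. Where \<open>curveA \<ge> 0\<close>, the \<open>a - k\<close> term then has
  the sign of \<open>a - k\<close> whatever the sign of \<open>u\<close>.\<close>

lemma curveF'_alt:
  "curveF' t = (2 * m * (k - z t - p - 2 * q * z t) + m * (a - k)) * curveF t
    - 2 * m * curveR m k p q (z t) + m * (a - k) * (m * (u t)\<^sup>2 + curveA m k p q (z t))"
  unfolding curveF'_def curveF_def by (simp add: power2_eq_square algebra_simps)

lemma tendsto_curve:
  assumes "(z \<longlongrightarrow> 0) G"
  shows "((\<lambda>t. curveA m k p q (z t)) \<longlongrightarrow> 0) G" "((\<lambda>t. curveB p q (z t)) \<longlongrightarrow> 0) G"
proof -
  have "isCont (curveA m k p q) 0" "isCont (curveB p q) 0"
    using deriv_curveA deriv_curveB DERIV_isCont by blast+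
  then show "((\<lambda>t. curveA m k p q (z t)) \<longlongrightarrow> 0) G" "((\<lambda>t. curveB p q (z t)) \<longlongrightarrow> 0) G"
    using isCont_tendsto_compose[OF _ assms] by (force simp: curveA_def curveB_def)+
qed

text \<open>The sign \<open>s\<close> says on which side of the critical parameter \<open>k\<close> we are: the upper branch
  of the orbit stays where \<open>s curveF > 0\<close>, the lower one where \<open>s curveF < 0\<close>,
  and the two branches cannot meet.\<close>
lemma curve_barrier:
  assumes s: "s = 1 \<or> s = - 1"
    and p: "0 < p" "p < k" "k \<le> 2 * p" and q: "3 / 2 + 4 * q \<ge> 0"
    and side: "s * (a - k) \<le> 0"
    and "0 < \<zeta>" and A_zero: "curveA m k p q \<zeta> = 0" and B_end: "s * curveB p q \<zeta> \<le> 0"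
    and A_nonneg: "\<And>y. \<lbrakk>0 < y; y \<le> \<zeta>\<rbrakk> \<Longrightarrow> curveA m k p q y \<ge> 0"
    and R_pos: "\<And>y. \<lbrakk>0 < y; y \<le> \<zeta>\<rbrakk> \<Longrightarrow> s * curveR m k p q y > 0"
  shows False
proof -
  have der: "((\<lambda>t. s * curveF t) has_real_derivative s * curveF' t) (at t)" for t
    by (rule DERIV_cmult[OF deriv_curveF])
  have side_m: "m * (s * (a - k)) \<le> 0"
    using m_pos by (intro mult_nonneg_nonpos side) simp
  have side_m2: "2 * m\<^sup>2 * (s * (a - k)) \<le> 0"
    by (intro mult_nonneg_nonpos side) simp
  \<comment> \<open>On the curve only the remainder and the \<open>a - k\<close> term survive, and
    both push \<open>s * curveF\<close> downwards.\<close>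
  have zero: "s * curveF' t < 0" if "s * curveF t = 0" "z t \<le> \<zeta>" for t
  proof -
    have "curveF t = 0" using that s by auto
    have "m * (s * (a - k)) * (m * (u t)\<^sup>2 + curveA m k p q (z t)) \<le> 0"
      using A_nonneg[OF z_pos that(2)] m_pos by (intro mult_nonpos_nonneg[OF side_m]) simp
    moreover have "2 * m * (s * curveR m k p q (z t)) > 0" using R_pos[OF z_pos that(2)] m_pos by simp
    ultimately show ?thesis
      unfolding curveF'_alt \<open>curveF t = 0\<close> by (simp add: algebra_simps)
  qed
  have upper: "s * curveF t0 > 0" if "\<tau> \<le> t0" "z t0 \<le> \<zeta>" for t0
  proof (rule pos_if_tendsto_0_at_top[OF der])
    have "(curveF \<longlongrightarrow> m * 0\<^sup>2 + 2 * m * 0 * 0 - 0) at_top"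
      unfolding curveF_def[abs_def] by (intro tendsto_intros u_top tendsto_curve z_top)
    then show "((\<lambda>t. s * curveF t) \<longlongrightarrow> 0) at_top" using tendsto_mult_right_zero by fastforce
  next
    fix t assume "t0 \<le> t" "s * curveF t = 0"
    then show "s * curveF' t < 0" using zero[of t] z_less_after[OF that(1), of t] that(2)
      by (cases "t = t0") auto
  next
    \<comment> \<open>Near the saddle the linear coefficient tends to a positive multiple of
      \<open>k - p\<close>, so negative values of \<open>s * curveF\<close> are driven away from
      0.\<close>
    have "((\<lambda>t. k - z t - p - 2 * q * z t) \<longlongrightarrow> k - 0 - p - 2 * q * 0) at_top"
      by (intro tendsto_intros z_top)
    then have "\<forall>\<^sub>F t in at_top. k - z t - p - 2 * q * z t > 0"
      using p by (intro order_tendstoD(1)) auto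
    moreover have "((\<lambda>t. p + q * z t) \<longlongrightarrow> p + q * 0) at_top"
      by (intro tendsto_intros z_top)
    then have "\<forall>\<^sub>F t in at_top. p + q * z t > 0"
      using p by (intro order_tendstoD(1)) auto
    moreover have "\<forall>\<^sub>F t in at_top. t > max t0 \<tau>" by (rule eventually_gt_at_top)
    ultimately show "\<forall>\<^sub>F t in at_top. s * curveF t < 0 \<longrightarrow> s * curveF' t < 0"
    proof eventually_elim
      case (elim t)
      show ?case
      proof
        assume neg: "s * curveF t < 0"
        have "z t \<le> \<zeta>" "u t > 0" using elim that z_less_after[OF that(1), of t] u_after[of t] by auto
        have "curveB p q (z t) > 0"
          using elim z_pos[of t] mult_pos_pos[of "z t" "p + q * z t"]
          by (simp add: curveB_def power2_eq_square algebra_simps)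
        then have "2 * m\<^sup>2 * (s * (a - k)) * (u t * (u t + curveB p q (z t))) \<le> 0"
          using \<open>u t > 0\<close> by (intro mult_nonpos_nonneg[OF side_m2]) simp
        moreover have "2 * m * (s * curveR m k p q (z t)) > 0"
          using R_pos[OF z_pos \<open>z t \<le> \<zeta>\<close>] m_pos by simp
        moreover have "2 * m * (k - z t - p - 2 * q * z t) * (s * curveF t) < 0"
          using elim m_pos by (intro mult_pos_neg[OF mult_pos_pos neg]) auto
        moreover have "s * curveF' t = 2 * m * (k - z t - p - 2 * q * z t) * (s * curveF t)
            - 2 * m * (s * curveR m k p q (z t))
            + 2 * m\<^sup>2 * (s * (a - k)) * (u t * (u t + curveB p q (z t)))"
          unfolding curveF'_def by (simp add: algebra_simps)
        ultimately show "s * curveF' t < 0" by linarith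
      qed
    qed
  qed
  have lower: "s * curveF t0 < 0" if "t0 \<le> \<tau>" "z t0 \<le> \<zeta>" for t0
  proof (rule neg_if_quotient_tendsto_0_at_bot[OF der deriv_z z_pos])
    \<comment> \<open>The linear bound on \<open>u\<close> controls the only term of
      \<open>curveF / z\<close> without an evident limit, namely
      \<open>u\<^sup>2 / z\<close>.\<close>
    obtain C where C: "C \<ge> 0" "\<And>t. t \<le> \<tau> \<Longrightarrow> - u t \<le> C * z t" using lower_branch_le_linear by blast
    have abs_u: "\<bar>u t\<bar> \<le> C * z t" if "t \<le> \<tau>" for t
      using C(2)[OF that] C(1) u_before[of t] u_turn that z_pos[of t] by (cases "t = \<tau>") auto
    have "((\<lambda>t. (u t)\<^sup>2 / z t) \<longlongrightarrow> 0) at_bot"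
    proof (rule Lim_null_comparison)
      show "((\<lambda>t. C * \<bar>u t\<bar>) \<longlongrightarrow> 0) at_bot"
        using tendsto_mult_right_zero[OF tendsto_rabs_zero[OF u_bot]] .
      have "(u t)\<^sup>2 / z t \<le> C * \<bar>u t\<bar>" if "t \<le> \<tau>" for t
        using mult_right_mono[OF abs_u[OF that], of "\<bar>u t\<bar>"] z_pos[of t]
        by (simp add: field_simps power2_eq_square)
      then show "\<forall>\<^sub>F t in at_bot. norm ((u t)\<^sup>2 / z t) \<le> C * \<bar>u t\<bar>"
        using z_pos by (intro eventually_at_bot_linorderI[of \<tau>]) (auto simp: abs_mult less_imp_le)
    qed
    then have "((\<lambda>t. s * (m * ((u t)\<^sup>2 / z t) + 2 * m * (p + q * z t) * u t - z t * (2 + m * p * (k - 2 * p)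
       + 2 * (m * (q * (k - 2 * p) - p * (1 + 4 * q)) - 1) / 3 * z t - m * q * (1 + 4 * q) / 2 * (z t)\<^sup>2)))
       \<longlongrightarrow> s * (m * 0 + 2 * m * (p + q * 0) * 0 - 0 * (2 + m * p * (k - 2 * p)
       + 2 * (m * (q * (k - 2 * p) - p * (1 + 4 * q)) - 1) / 3 * 0 - m * q * (1 + 4 * q) / 2 * 0\<^sup>2))) at_bot"
      by (intro tendsto_intros z_bot u_bot) auto
    moreover have "s * curveF t / z t = s * (m * ((u t)\<^sup>2 / z t) + 2 * m * (p + q * z t) * u t - z t * (2 + m * p * (k - 2 * p)
       + 2 * (m * (q * (k - 2 * p) - p * (1 + 4 * q)) - 1) / 3 * z t - m * q * (1 + 4 * q) / 2 * (z t)\<^sup>2))" for t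
      using z_pos[of t] unfolding curveF_def curveA_def curveB_def
      by (simp add: field_simps power2_eq_square)
    ultimately show "((\<lambda>t. s * curveF t / z t) \<longlongrightarrow> 0) at_bot" by simp
  next
    fix t assume "t \<le> t0" "s * curveF t = 0"
    then show "s * curveF' t < 0" using zero[of t] z_less_before[OF _ that(1), of t] that(2)
      by (cases "t = t0") auto
  next
    have "\<forall>\<^sub>F t in at_bot. z t < 2" using z_bot by (rule order_tendstoD) simp
    moreover have "\<forall>\<^sub>F t in at_bot. t < min t0 \<tau>" by (rule eventually_gt_at_bot)
    ultimately show "\<forall>\<^sub>F t in at_bot. s * curveF t > 0 \<longrightarrow> s * curveF' t * z t - s * curveF t * - (m * u t) < 0"
    proof eventually_elim
      case (elim t)
      show ?case
      proof
        assume pos: "s * curveF t > 0"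
        have zt: "z t \<le> \<zeta>" using elim that z_less_before[of t t0] by auto
        \<comment> \<open>The parabola bounds the derivative of \<open>z\<close> from below. It
          turns the coefficient of \<open>s * curveF\<close> into
          \<open>m * (z * (k - 2 * p) - z\<^sup>2 * (3 / 2 + 4 * q))\<close>, whence the conditions
          \<open>k \<le> 2 * p\<close> and \<open>3 / 2 + 4 * q \<ge> 0\<close>.\<close>
        have "- u t > a * z t - (z t)\<^sup>2 / 2" using lower_branch_gt[of t a] elim by simp
        then have "m * u t \<le> m * ((z t)\<^sup>2 / 2 - a * z t)" using m_pos by simp
        moreover have "(2 * m * (k - z t - p - 2 * q * z t) + m * (a - k)) * z t + m * ((z t)\<^sup>2 / 2 - a * z t)
            = m * (z t * (k - 2 * p) - (z t)\<^sup>2 * (3 / 2 + 4 * q))"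
          by (simp add: power2_eq_square field_simps)
        moreover have "m * (z t * (k - 2 * p) - (z t)\<^sup>2 * (3 / 2 + 4 * q)) \<le> 0"
        proof -
          have "z t * (k - 2 * p) \<le> 0" using p z_pos[of t] by (intro mult_nonneg_nonpos) auto
          moreover have "(z t)\<^sup>2 * (3 / 2 + 4 * q) \<ge> 0" using q by (intro mult_nonneg_nonneg) auto
          ultimately show ?thesis using m_pos by (intro mult_nonneg_nonpos) auto
        qed
        ultimately have "((2 * m * (k - z t - p - 2 * q * z t) + m * (a - k)) * z t + m * u t) * (s * curveF t) \<le> 0"
          using pos by (intro mult_nonpos_nonneg) auto
        moreover have "2 * m * (s * curveR m k p q (z t)) * z t > 0"
          using R_pos[OF z_pos zt] m_pos z_pos[of t] by simp
        moreover have "m * (s * (a - k)) * (m * (u t)\<^sup>2 + curveA m k p q (z t)) * z t \<le> 0"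
          using A_nonneg[OF z_pos zt] m_pos z_pos[of t]
          by (intro mult_nonpos_nonneg[OF mult_nonpos_nonneg[OF side_m]]) auto
        moreover have "s * curveF' t * z t - s * curveF t * - (m * u t)
            = ((2 * m * (k - z t - p - 2 * q * z t) + m * (a - k)) * z t + m * u t) * (s * curveF t)
            - 2 * m * (s * curveR m k p q (z t)) * z t
            + m * (s * (a - k)) * (m * (u t)\<^sup>2 + curveA m k p q (z t)) * z t"
          unfolding curveF'_alt by (simp add: algebra_simps)
        ultimately show "s * curveF' t * z t - s * curveF t * - (m * u t) < 0" by linarith
      qed
    qed
  qed
  show False
  proof (cases "z \<tau> \<le> \<zeta>")
    case True
    then show False using upper[of \<tau>] lower[of \<tau>] by simp
  next
    case False
    obtain t1 where t1: "\<tau> < t1" "z t1 = \<zeta>" using obtain_after[OF \<open>0 < \<zeta>\<close>] False by auto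
    obtain t2 where t2: "t2 < \<tau>" "z t2 = \<zeta>" using obtain_before[OF \<open>0 < \<zeta>\<close>] False by auto
    \<comment> \<open>If the orbit passes \<open>\<zeta>\<close>, the curve factors there into the
      axis and \<open>u = - 2 * curveB p q \<zeta>\<close>. The sign of \<open>curveB\<close> at
      \<open>\<zeta>\<close> contradicts the lower branch for \<open>s = 1\<close> and the upper
      branch for \<open>s = - 1\<close>.\<close>
    have F_eq: "curveF t = m * (u t * (u t + 2 * curveB p q \<zeta>))" if "z t = \<zeta>" for t
      unfolding curveF_def that A_zero by (simp add: power2_eq_square algebra_simps)
    from s show False
    proof
      assume "s = 1"
      then have "u t2 * (u t2 + 2 * curveB p q \<zeta>) < 0" "curveB p q \<zeta> \<le> 0"
        using lower[of t2] t2 F_eq[of t2] m_pos B_end by (auto simp: mult_less_0_iff)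
      then show False using u_before[OF t2(1)] by (auto simp: mult_less_0_iff)
    next
      assume "s = - 1"
      then have "u t1 * (u t1 + 2 * curveB p q \<zeta>) < 0" "curveB p q \<zeta> \<ge> 0"
        using upper[of t1] t1 F_eq[of t1] m_pos B_end by (auto simp: mult_less_0_iff)
      then show False using u_after[OF t1(1)] by (auto simp: mult_less_0_iff)
    qed
  qed
qed

end

end

section \<open>Parameters excluded by barriers\<close>

text \<open>Nonpositive \<open>c1\<close> and \<open>c2\<close> make the quadratic nonincreasing for
  \<open>y > 0\<close>, so it is nonnegative up to the root given by the intermediate value
  theorem.\<close>

lemma quadratic_first_root:
  fixes c0 c1 c2 :: real
  assumes "c1 \<le> 0" "c2 \<le> 0" and "l \<le> r" "0 \<le> l"
    and "c0 + c1 * l + c2 * l\<^sup>2 \<ge> 0" "c0 + c1 * r + c2 * r\<^sup>2 \<le> 0"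
  obtains \<zeta> where "l \<le> \<zeta>" "\<zeta> \<le> r" "c0 + c1 * \<zeta> + c2 * \<zeta>\<^sup>2 = 0"
    "\<And>y. \<lbrakk>0 < y; y \<le> \<zeta>\<rbrakk> \<Longrightarrow> c0 + c1 * y + c2 * y\<^sup>2 \<ge> 0"
proof -
  have "continuous_on {l..r} (\<lambda>y. c0 + c1 * y + c2 * y\<^sup>2)" by (intro continuous_intros)
  with IVT2'[of "\<lambda>y. c0 + c1 * y + c2 * y\<^sup>2" r 0 l] assms
  obtain \<zeta> where \<zeta>: "l \<le> \<zeta>" "\<zeta> \<le> r" "c0 + c1 * \<zeta> + c2 * \<zeta>\<^sup>2 = 0" by auto
  have "c0 + c1 * y + c2 * y\<^sup>2 \<ge> 0" if "0 < y" "y \<le> \<zeta>" for y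
  proof -
    have "c1 * y \<ge> c1 * \<zeta>" "c2 * y\<^sup>2 \<ge> c2 * \<zeta>\<^sup>2"
      using that assms by (auto intro!: mult_left_mono_neg power_mono)
    then show ?thesis using \<zeta>(3) by linarith
  qed
  then show thesis using that \<zeta> by blast
qed

lemma lower_remainder_pos:
  fixes m z :: real
  assumes m: "0 < m" "m \<le> 7 / 2" and z: "0 < z" "z \<le> 33 / 10"
  shows "curveR m (12 / 7) (6 / 7 + m / 75) (- (2 / 7)) z > 0"
proof -
  define S where "S = 4/75 + 24/1225 * m - 2/421875 * m^3
    - z * (1423/15435 + 52/3675 * m + 8/118125 * m\<^sup>2)
    + z\<^sup>2 * (18/343 + 3/1225 * m) - 3/343 * z^3"
  have "m * z \<le> m * (33/10)" using m z by (intro mult_left_mono) auto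
  moreover have "m * (m * z) \<le> 7/2 * (m * (33/10))" using m z by (intro mult_mono) auto
  moreover have "m * (m * m) \<le> 7/2 * (7/2 * m)" using m by (intro mult_mono) auto
  \<comment> \<open>The part of \<open>S\<close> cubic in \<open>z\<close> is a combination, with
    weights \<open>7/2 - m\<close> and \<open>m\<close>, of two cubics with a double root,
    nonnegative for \<open>z \<le> 33/10\<close>. The monomial bounds handle the rest.\<close>
  moreover have "(7/2 - m) * ((z - 13/10)\<^sup>2 * (102/10 - 3 * z)) \<ge> 0"
    "m * ((z - 183/100)\<^sup>2 * (996/100 - 3 * z)) \<ge> 0"
    using m z by (auto intro!: mult_nonneg_nonneg)
  moreover have "2401/2 * S = (7/2 - m) * ((z - 13/10)\<^sup>2 * (102/10 - 3 * z))
    + m * ((z - 183/100)\<^sup>2 * (996/100 - 3 * z)) + (11081/3000 + 1850739/250000 * m - 203/1800 * z - 62291/30000 * (m * z))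
    - 2401/421875 * (m * (m * m)) - 1372/16875 * (m * (m * z))"
    unfolding S_def by (simp add: field_simps power2_eq_square power3_eq_cube)
  ultimately have "S > 0" using m z by linarith
  then have "z\<^sup>2 * (m * S) > 0" using m z by simp
  also have "z\<^sup>2 * (m * S) = curveR m (12 / 7) (6 / 7 + m / 75) (- (2 / 7)) z"
    unfolding S_def curveR_def curveA_def curveB_def
    by (simp add: field_simps power2_eq_square power3_eq_cube)
  finally show ?thesis .
qed

context bt_saddle_loop
begin

text \<open>As \<open>m\<close> tends to \<open>0\<close>, the loop is approximated to first order by the curve with
  \<open>B = 2 / 7 z (3 - z)\<close>; the correction \<open>m / 75\<close> makes the remainder, which vanishes to first order,
  positive up to \<open>m = 7 / 2\<close>.\<close>
lemma lower_bound_small: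
  assumes "m \<le> 7 / 2"
  shows "a > 12 / 7"
proof (rule ccontr)
  assume "\<not> a > 12 / 7"
  define p where "p = 6 / 7 + m / 75"
  define q :: real where "q = - (2 / 7)"
  have p: "6 / 7 < p" "p \<le> 6 / 7 + 7 / 150" using m_pos assms by (auto simp: p_def)
  define c0 where "c0 = 2 + m * p * (12 / 7 - 2 * p)"
  define c1 where "c1 = 2 * (m * (q * (12 / 7 - 2 * p) - p * (1 + 4 * q)) - 1) / 3"
  define c2 where "c2 = - (m * q * (1 + 4 * q) / 2)"
  have A: "curveA m (12 / 7) p q y = y\<^sup>2 * (c0 + c1 * y + c2 * y\<^sup>2)" for y
    by (simp add: curveA_def c0_def c1_def c2_def)
  have c0: "c0 = 2 - 4/175 * m\<^sup>2 - 2/5625 * m^3"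
    and c1: "c1 = - 2/3 + 4/49 * m + 2/315 * m\<^sup>2" and c2: "c2 = - (m / 49)"
    by (simp_all add: c0_def c1_def c2_def p_def q_def field_simps power2_eq_square power3_eq_cube)
  have m2: "m\<^sup>2 \<le> 7/2 * m" "m\<^sup>2 \<ge> 0" using m_pos assms by (simp_all add: power2_eq_square)
  have m3: "m^3 \<le> 49/4 * m" "m^3 \<ge> 0"
  proof -
    have "m\<^sup>2 * m \<le> 7/2 * m * m" using m2 m_pos by (intro mult_right_mono) auto
    then show "m^3 \<le> 49/4 * m" using m2 by (simp add: power2_eq_square power3_eq_cube)
  qed (use m_pos in simp)
  have "c1 \<le> 0" "c2 \<le> 0" using m2 m_pos assms unfolding c1 c2 by linarith+
  \<comment> \<open>\<open>7 / 2 * p\<close> is the positive zero of \<open>curveB\<close>; a root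
    of \<open>curveA\<close> beyond it satisfies the end condition of the barrier.
    \<open>33 / 10\<close> is the range in which the remainder is known to be positive.\<close>
  moreover have "7 / 2 * p \<le> 33 / 10" "0 \<le> 7 / 2 * p" using p by auto
  moreover have "c0 + c1 * (7 / 2 * p) + c2 * (7 / 2 * p)\<^sup>2 \<ge> 0"
  proof -
    have "c0 + c1 * (7 / 2 * p) + c2 * (7 / 2 * p)\<^sup>2 = 332/11025 * m - m\<^sup>2 / 175 - 7/67500 * m^3"
      unfolding c0 c1 c2 p_def by (simp add: field_simps power2_eq_square power3_eq_cube)
    then show ?thesis using m2 m3 m_pos assms by linarith
  qed
  moreover have "c0 + c1 * (33 / 10) + c2 * (33 / 10)\<^sup>2 \<le> 0"
  proof -
    have "c0 + c1 * (33 / 10) + c2 * (33 / 10)\<^sup>2 = - 1/5 + 33/700 * m - m\<^sup>2 / 525 - 2/5625 * m^3"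
      unfolding c0 c1 c2 by (simp add: field_simps power2_eq_square power3_eq_cube)
    then show ?thesis using m2 m3 m_pos assms by linarith
  qed
  ultimately obtain \<zeta> where \<zeta>: "7 / 2 * p \<le> \<zeta>" "\<zeta> \<le> 33 / 10" "c0 + c1 * \<zeta> + c2 * \<zeta>\<^sup>2 = 0"
    "\<And>y. \<lbrakk>0 < y; y \<le> \<zeta>\<rbrakk> \<Longrightarrow> c0 + c1 * y + c2 * y\<^sup>2 \<ge> 0"
    by (rule quadratic_first_root) blast
  show False
  proof (rule curve_barrier[of 1 p "12 / 7" q \<zeta>])
    show "0 < p" "p < 12 / 7" "12 / 7 \<le> 2 * p" "0 < \<zeta>" using p \<zeta> by auto
    show "1 * curveB p q \<zeta> \<le> 0"
      using \<zeta>(1) p mult_left_mono[of "7 / 2 * p" \<zeta> \<zeta>]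
      by (simp add: curveB_def q_def power2_eq_square)
    show "0 < 1 * curveR m (12 / 7) p q y" if "0 < y" "y \<le> \<zeta>" for y
      using lower_remainder_pos[OF m_pos assms that(1)] that \<zeta>(2) by (simp add: p_def q_def)
    show "curveA m (12 / 7) p q \<zeta> = 0" using \<zeta>(3) by (simp add: A)
    show "curveA m (12 / 7) p q y \<ge> 0" if "0 < y" "y \<le> \<zeta>" for y
      using \<zeta>(4)[OF that] by (simp add: A)
  qed (use \<open>\<not> a > 12 / 7\<close> in \<open>auto simp: q_def\<close>)
qed

text \<open>With \<open>p = k / 2\<close> the curve has the tangents at the saddle of the flow for \<open>a = k\<close>, so that
  \<open>R = z\<^sup>3 (c1 + c2 z + c3 z\<^sup>2)\<close>; \<open>root\<close> says that \<open>A\<close> vanishes no later than \<open>B\<close>.\<close>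
lemma upper_bound_criterion:
  fixes k \<sigma> :: real
  defines "p \<equiv> k / 2" and "q \<equiv> (\<sigma> - 1) / 4" and "\<mu> \<equiv> m * \<sigma>"
  defines "c1 \<equiv> 2 + 6 * q - p / 3 + 2 / 3 * \<mu> * p\<^sup>2"
    and "c2 \<equiv> - (2 / 3) - 7 / 3 * q - \<mu> * p * (2 / 3 + 5 / 6 * q)"
    and "c3 \<equiv> - ((1 + 2 * q) * \<mu> * q / 2)"
  assumes k: "k > 0" and \<sigma>: "- (1 / 2) \<le> \<sigma>" "\<sigma> < 0" and "\<mu> * p \<ge> - 1"
    and root: "2 * q + 2 / 3 * p + \<mu> * p\<^sup>2 / 6 \<ge> 0"
    and disc: "c2\<^sup>2 < 4 * c1 * c3"
  shows "a < k"
proof (rule ccontr)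
  assume "\<not> a < k"
  have q: "q < 0" "1 + 2 * q > 0" "1 + 4 * q = \<sigma>" using \<sigma> by (auto simp: q_def field_simps)
  have p: "p > 0" "k = 2 * p" using k by (auto simp: p_def)
  have "\<mu> < 0" unfolding \<mu>_def using \<sigma> m_pos by (simp add: mult_pos_neg)
  then have "(1 + 2 * q) * \<mu> * q > 0"
    using q by (intro mult_neg_neg mult_pos_neg) auto
  then have c3: "c3 < 0" unfolding c3_def by simp
  define d1 where "d1 = 2 * (m * (q * (k - 2 * p) - p * (1 + 4 * q)) - 1) / 3"
  define d2 where "d2 = - (m * q * (1 + 4 * q) / 2)"
  have A: "curveA m k p q y = y\<^sup>2 * (2 + d1 * y + d2 * y\<^sup>2)" for y
    by (simp add: curveA_def d1_def d2_def p(2))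
  have R: "curveR m k p q y = y^3 * (c1 + c2 * y + c3 * y\<^sup>2)" for y
    unfolding curveR_def curveA_def curveB_def c1_def c2_def c3_def \<mu>_def q(3)[symmetric] p(2)
    by (simp add: field_simps power2_eq_square power3_eq_cube)
  \<comment> \<open>\<open>r\<close> is the zero of \<open>curveB\<close>. The hypothesis
    \<open>root\<close> is \<open>q\<close> times the quadratic factor of \<open>curveA\<close> at
    \<open>r\<close>, so that factor is nonpositive there because \<open>q < 0\<close>.\<close>
  define r where "r = - (p / q)"
  have "r > 0" unfolding r_def using p q by (simp add: divide_pos_neg)
  have qr: "q * r = - p" unfolding r_def using q by simp
  have d: "d1 \<le> 0" "d2 \<le> 0"
  proof -
    show "d1 \<le> 0" unfolding d1_def q(3) p(2) using \<open>\<mu> * p \<ge> - 1\<close>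
      by (simp add: \<mu>_def algebra_simps)
    have "m * q * \<sigma> > 0" using m_pos q \<sigma> by (simp add: mult_pos_neg mult_neg_neg)
    then show "d2 \<le> 0" unfolding d2_def q(3) by simp
  qed
  have "2 + d1 * r + d2 * r\<^sup>2 \<le> 0"
  proof -
    have "q * (2 + d1 * r + d2 * r\<^sup>2) = 2 * q + d1 * (q * r) - m * \<sigma> / 2 * (q * r)\<^sup>2"
      unfolding d2_def q(3) by (simp add: algebra_simps power2_eq_square)
    also have "\<dots> = 2 * q + 2 / 3 * p + \<mu> * p\<^sup>2 / 6"
      unfolding qr d1_def \<mu>_def q(3) p(2) by (simp add: field_simps power2_eq_square)
    finally have "q * (2 + d1 * r + d2 * r\<^sup>2) \<ge> 0" using root by simp
    then show ?thesis using q by (simp add: zero_le_mult_iff)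
  qed
  with d obtain \<zeta> where \<zeta>: "0 \<le> \<zeta>" "\<zeta> \<le> r" "2 + d1 * \<zeta> + d2 * \<zeta>\<^sup>2 = 0"
    "\<And>y. \<lbrakk>0 < y; y \<le> \<zeta>\<rbrakk> \<Longrightarrow> 2 + d1 * y + d2 * y\<^sup>2 \<ge> 0"
    using quadratic_first_root[of d1 d2 0 r 2] \<open>r > 0\<close> by auto
  have "\<zeta> > 0" using \<zeta>(1,3) by (cases "\<zeta> = 0") auto
  show False
  proof (rule curve_barrier[of "- 1" p k q \<zeta>])
    show "- 1 * curveB p q \<zeta> \<le> 0"
    proof -
      have "q * \<zeta> \<ge> - p" using mult_left_mono_neg[OF \<zeta>(2), of q] q qr by simp
      then have "\<zeta> * (p + q * \<zeta>) \<ge> 0" using \<open>\<zeta> > 0\<close> by simp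
      then show ?thesis by (simp add: curveB_def power2_eq_square algebra_simps)
    qed
    show "0 < - 1 * curveR m k p q y" if "0 < y" "y \<le> \<zeta>" for y
    proof -
      \<comment> \<open>Completing the square: negative discriminant and \<open>c3 < 0\<close> make
        the quadratic factor of the remainder negative.\<close>
      have "4 * c3 * (c1 + c2 * y + c3 * y\<^sup>2) = (2 * c3 * y + c2)\<^sup>2 + (4 * c1 * c3 - c2\<^sup>2)"
        by (simp add: algebra_simps power2_eq_square)
      also have "\<dots> > 0" using disc by (intro add_nonneg_pos) auto
      finally have "c1 + c2 * y + c3 * y\<^sup>2 < 0" using c3 by (simp add: zero_less_mult_iff)
      then show ?thesis unfolding R using that by (simp add: mult_pos_neg)
    qed
    show "curveA m k p q \<zeta> = 0" using \<zeta>(3) by (simp add: A)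
    show "curveA m k p q y \<ge> 0" if "0 < y" "y \<le> \<zeta>" for y
      using \<zeta>(4)[OF that] by (simp add: A)
  qed (use p q \<sigma> \<open>\<zeta> > 0\<close> \<open>\<not> a < k\<close> in auto)
qed

text \<open>The criterion is applied with \<open>k = 2 - 2 / T\<close> and
  \<open>\<sigma> = - (1 / S)\<close>. The scaling \<open>w = 37 / 24 * m\<close> makes all
  quantities rational in \<open>w\<close> with denominators \<open>S\<close> and \<open>T\<close>,
  and the discriminant condition becomes \<open>N2\<^sup>2 < 4 * N1 * N3\<close>.\<close>

lemma upper_bound_small:
  assumes "m \<le> 7"
  shows "a < 2 - 2 / (7 + 37 / 12 * m)"
proof -
  define w where "w = 37 / 24 * m"
  have w: "w > 0" "w \<le> 11" and m_eq: "m = 24 / 37 * w"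
    using m_pos assms by (auto simp: w_def)
  define S where "S = 7 + w"
  define T where "T = 7 + 2 * w"
  have pos: "S > 0" "T > 0" "S \<noteq> 0" "T \<noteq> 0" using w by (auto simp: S_def T_def)
  have nz: "7 + w \<noteq> 0" "7 + 2 * w \<noteq> 0" using w by auto
  define p where "p = (6 + 2 * w) / T"
  define q where "q = - ((8 + w) / (4 * S))"
  define \<mu> where "\<mu> = - (24 / 37 * w / S)"
  define N1 where "N1 = 2161/222 + 236/37 * w + 118/111 * w\<^sup>2"
  define N2 where "N2 = 3371/444 + 581/148 * w + 95/222 * w\<^sup>2"
  define N3 where "N3 = 72/37 + 21/37 * w + 3/74 * w\<^sup>2"
  define N4 where "N4 = 1985/222 + 126/37 * w + 26/111 * w\<^sup>2"
  note defs = p_def q_def \<mu>_def S_def T_def N1_def N2_def N3_def N4_def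
  have p_eq: "(2 - 2 / T) / 2 = p" and q_eq: "(- (1 / S) - 1) / 4 = q" and \<mu>_eq: "m * (- (1 / S)) = \<mu>"
    unfolding m_eq defs using nz by (simp_all add: field_simps)
  have c1: "2 + 6 * q - p / 3 + 2 / 3 * \<mu> * p\<^sup>2 = - (w * N1 / (S * T\<^sup>2))"
    unfolding defs using nz by (simp add: divide_simps) (simp add: algebra_simps power2_eq_square)
  have c2: "- (2 / 3) - 7 / 3 * q - \<mu> * p * (2 / 3 + 5 / 6 * q) = w * N2 / (S\<^sup>2 * T)"
    unfolding defs using nz by (simp add: divide_simps) (simp add: algebra_simps power2_eq_square)
  have c3: "- ((1 + 2 * q) * \<mu> * q / 2) = - (w * N3 / S^3)"
    unfolding defs using nz by (simp add: divide_simps) (simp add: algebra_simps power2_eq_square power3_eq_cube)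
  have root: "2 * q + 2 / 3 * p + \<mu> * p\<^sup>2 / 6 = w * N4 / (S * T\<^sup>2)"
    unfolding defs using nz by (simp add: divide_simps) (simp add: algebra_simps power2_eq_square)
  have disc: "N2\<^sup>2 < 4 * N1 * N3"
  proof -
    \<comment> \<open>Only the quartic coefficient of \<open>4 * N1 * N3 - N2\<^sup>2\<close> is
      negative; for \<open>w \<le> 11\<close> the quadratic term absorbs it.\<close>
    have "w^4 \<le> 121 * w\<^sup>2"
      using power_mono[OF w(2), of 2] w mult_right_mono[of "w\<^sup>2" 121 "w\<^sup>2"]
      by (simp add: power2_eq_square power4_eq_xxxx algebra_simps)
    moreover have "4 * N1 * N3 - N2\<^sup>2 = 3573191/197136 + 398777/32856 * w + 478043/197136 * w\<^sup>2
      + 1445/16428 * w^3 - 529/49284 * w^4"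
      unfolding N1_def N2_def N3_def
      by (simp add: field_simps power2_eq_square power3_eq_cube power4_eq_xxxx)
    moreover have "w^3 \<ge> 0" "w\<^sup>2 \<ge> 0" using w by auto
    ultimately show ?thesis using w by linarith
  qed
  have "a < 2 - 2 / T"
  proof (rule upper_bound_criterion[of "2 - 2 / T" "- (1 / S)"], unfold p_eq q_eq \<mu>_eq c1 c2 c3 root)
    show "0 < 2 - 2 / T" "- (1 / 2) \<le> - (1 / S)" "- (1 / S) < 0"
      using w by (simp_all add: S_def T_def field_simps)
    have "24 / 37 * w / S \<le> 1" "p \<le> 1" "0 \<le> p" using w by (simp_all add: S_def T_def p_def field_simps)
    then have "24 / 37 * w / S * p \<le> 1" using w pos by (intro mult_le_one) auto
    then show "- 1 \<le> \<mu> * p" by (simp add: \<mu>_def)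
    show "0 \<le> w * N4 / (S * T\<^sup>2)" using w pos by (simp add: N4_def)
    have "(w * N2 / (S\<^sup>2 * T))\<^sup>2 = w\<^sup>2 * N2\<^sup>2 / (S^4 * T\<^sup>2)"
      by (simp add: power_divide power_mult_distrib flip: power_mult)
    also have "\<dots> < w\<^sup>2 * (4 * N1 * N3) / (S^4 * T\<^sup>2)"
      using disc w pos by (intro divide_strict_right_mono mult_strict_left_mono) auto
    also have "\<dots> = 4 * - (w * N1 / (S * T\<^sup>2)) * - (w * N3 / S^3)"
      using pos by (simp add: field_simps power2_eq_square power3_eq_cube power4_eq_xxxx)
    finally show "(w * N2 / (S\<^sup>2 * T))\<^sup>2 < 4 * - (w * N1 / (S * T\<^sup>2)) * - (w * N3 / S^3)" .
  qed
  then show ?thesis by (simp add: T_def w_def)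
qed

text \<open>The choice \<open>\<sigma> = - (2 / 5 * n)\<close> makes \<open>m * \<sigma>\<close>
  constant, so the conditions of the criterion become polynomial inequalities in
  \<open>n = 1 / m\<close> on a short interval.\<close>

lemma upper_bound_medium:
  assumes "7 \<le> m" "m \<le> 11"
  shows "a < 2 - 1 / m + 25 / (7 * m\<^sup>2)"
proof -
  define n where "n = 1 / m"
  have n: "1 / 11 \<le> n" "n \<le> 1 / 7" using assms by (simp_all add: n_def field_simps)
  define p where "p = 1 - n / 2 + 25 / 14 * n\<^sup>2"
  define q where "q = - (1 / 4) - n / 10"
  define k where "k = 2 - n + 25 / 7 * n\<^sup>2"
  define \<sigma> where "\<sigma> = - (2 / 5 * n)"
  have p_eq: "k / 2 = p" and q_eq: "(\<sigma> - 1) / 4 = q" and \<mu>_eq: "m * \<sigma> = - (2 / 5)"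
    using m_pos by (simp_all add: k_def p_def q_def \<sigma>_def n_def field_simps)
  have n2: "n\<^sup>2 \<ge> 1 / 11 * n" "n\<^sup>2 \<le> 1 / 7 * n"
    using n by (auto simp: power2_eq_square intro!: mult_right_mono)
  have n3: "n^3 \<ge> 1 / 11 * n\<^sup>2" "n^3 \<le> 1 / 7 * n\<^sup>2"
    using n by (auto simp: power2_eq_square power3_eq_cube intro!: mult_right_mono)
  have n4: "n^4 \<ge> 0" "n^4 \<le> 1 / 7 * n^3"
    using n by (auto simp: power3_eq_cube power4_eq_xxxx intro!: mult_right_mono)
  have c1: "2 + 6 * q - p / 3 + 2 / 3 * - (2 / 5) * p\<^sup>2
      = - (1/10 + 1/6 * n + 113/70 * n\<^sup>2 - 10/21 * n^3 + 125/147 * n^4)"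
    unfolding p_def q_def by (simp add: field_simps power2_eq_square power3_eq_cube power4_eq_xxxx)
  have c2: "- (2 / 3) - 7 / 3 * q - - (2 / 5) * p * (2 / 3 + 5 / 6 * q)
      = 1/10 + 13/120 * n + 289/840 * n\<^sup>2 - 5/84 * n^3"
    unfolding p_def q_def by (simp add: field_simps power2_eq_square power3_eq_cube)
  have c3: "- ((1 + 2 * q) * - (2 / 5) * q / 2) = - (1/40 - n\<^sup>2 / 250)"
    unfolding q_def by (simp add: field_simps power2_eq_square)
  \<comment> \<open>\<open>L1\<close> bounds \<open>- c1\<close> from below and \<open>L2\<close>
    bounds \<open>c2\<close> from above. These linear bounds reduce the discriminant condition to a
    quadratic inequality in \<open>n\<close>.\<close>
  define L1 where "L1 = 869/10000 + 451/1000 * n"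
  define L2 where "L2 = 958/10000 + 1862/10000 * n"
  have "a < k"
  proof (rule upper_bound_criterion[of k \<sigma>], unfold p_eq q_eq \<mu>_eq c1 c2 c3)
    show "0 < k" using n n2 by (simp add: k_def)
    show "- (1 / 2) \<le> \<sigma>" "\<sigma> < 0" using n by (simp_all add: \<sigma>_def)
    show "- 1 \<le> - (2 / 5) * p" using n n2 by (simp add: p_def)
    have "2 * q + 2 / 3 * p + - (2 / 5) * p\<^sup>2 / 6
        = 1/10 - 7/15 * n + 131/140 * n\<^sup>2 + 5/42 * n^3 - 125/588 * n^4"
      unfolding p_def q_def by (simp add: field_simps power2_eq_square power3_eq_cube power4_eq_xxxx)
    then show "0 \<le> 2 * q + 2 / 3 * p + - (2 / 5) * p\<^sup>2 / 6" using n n2 n3 n4 by linarith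
    have lin: "(n - 1 / 11) * (1 / 7 - n) \<ge> 0" using n by simp
    \<comment> \<open>Tangent of \<open>n\<^sup>2\<close> at \<open>71 / 773\<close>, close to the
      endpoint \<open>1 / 11\<close>; \<open>lin\<close> above is the chord over the
      interval.\<close>
    have sq: "n\<^sup>2 - 142/773 * n + 5041/597529 \<ge> 0"
      using zero_le_power2[of "n - 71/773"] by (simp add: power2_eq_square algebra_simps)
    have L1: "L1 \<le> 1/10 + 1/6 * n + 113/70 * n\<^sup>2 - 10/21 * n^3 + 125/147 * n^4"
      using n3(2) n4(1) n(2) sq unfolding L1_def by linarith
    have L2: "1/10 + 13/120 * n + 289/840 * n\<^sup>2 - 5/84 * n^3 \<le> L2"
      using n3 lin n by (simp add: L2_def power2_eq_square algebra_simps)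
    have "(1/10 + 13/120 * n + 289/840 * n\<^sup>2 - 5/84 * n^3)\<^sup>2 \<le> L2\<^sup>2"
      using L2 n n2 n3 by (intro power_mono) auto
    \<comment> \<open>The last factor is a lower bound for \<open>1/40 - n\<^sup>2 / 250\<close>
      when \<open>n \<le> 1 / 7\<close>.\<close>
    also have "L2\<^sup>2 < 4 * L1 * (24918 / 1000000)"
      using lin n by (simp add: L1_def L2_def power2_eq_square algebra_simps)
    also have "\<dots> \<le> 4 * (1/10 + 1/6 * n + 113/70 * n\<^sup>2 - 10/21 * n^3 + 125/147 * n^4)
        * (1/40 - n\<^sup>2 / 250)"
      using L1 n n2 by (intro mult_mono) (auto simp: L1_def)
    finally show "(1/10 + 13/120 * n + 289/840 * n\<^sup>2 - 5/84 * n^3)\<^sup>2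
        < 4 * - (1/10 + 1/6 * n + 113/70 * n\<^sup>2 - 10/21 * n^3 + 125/147 * n^4) * - (1/40 - n\<^sup>2 / 250)"
      by (simp only: mult_minus_left mult_minus_right minus_minus)
  qed
  then show ?thesis by (simp add: k_def n_def power_divide)
qed

end

text \<open>For large \<open>m\<close> the upper branch follows the slow curve \<open>u \<approx> z / m\<close> and is forced down to the axis
  well before the lower branch gets there.\<close>

lemma slow_barrier_inequality:
  fixes m a z X U :: real
  assumes m: "11 \<le> m" and a: "a \<ge> 2 - 1 / m + 25 / (7 * m\<^sup>2)" and z: "0 < z" "z \<le> 16 / 5"
    and X: "X = m * (16 / 5 - z) / 3" and U: "U = 1 / (1 + X\<^sup>2)"
  shows "X\<^sup>2 * U * (X\<^sup>2 * U / m - 2 / 3 * z * X * U\<^sup>2 + a - z) - (2 - z) > 0"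
proof -
  have "X \<ge> 0" using m z unfolding X by (intro divide_nonneg_nonneg mult_nonneg_nonneg) auto
  have "1 + X\<^sup>2 > 0" by (simp add: add_pos_nonneg)
  then have U_pos: "U > 0" and UX: "U + X\<^sup>2 * U = 1" by (simp_all add: U field_simps)
  define y where "y = 16 / 5 - z"
  have mX: "X / m = y / 3" using m by (simp add: X y_def)
  have X3: "3 * X^3 \<le> (1 + X\<^sup>2)\<^sup>2"
  proof -
    have "(1 + X\<^sup>2)\<^sup>2 - 3 * X^3 = (X\<^sup>2 - 3 / 2 * X - 1 / 2)\<^sup>2 + 3 / 4 * (X - 1)\<^sup>2"
      by (simp add: field_simps power2_eq_square power3_eq_cube)
    also have "\<dots> \<ge> 0" by simp
    finally show ?thesis by simp
  qed
  have X3U: "X^3 * U\<^sup>2 \<le> 1 / 3"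
    using X3 \<open>1 + X\<^sup>2 > 0\<close> by (simp add: U power_divide field_simps)
  have X2U: "X\<^sup>2 * U \<le> 1" "X\<^sup>2 * U \<ge> 0" using UX U_pos by (auto simp: field_simps)
  \<comment> \<open>Since \<open>X / m = y / 3\<close>, the term \<open>25 / (7 * m\<^sup>2)\<close>
    of the bound yields a gain independent of \<open>m\<close>.\<close>
  have a': "X\<^sup>2 * (a - 2 + 1 / m) \<ge> 25 / 63 * y\<^sup>2"
  proof -
    have "X\<^sup>2 * (25 / (7 * m\<^sup>2)) = 25 / 7 * (X / m)\<^sup>2" using m by (simp add: field_simps)
    also have "\<dots> = 25 / 63 * y\<^sup>2" by (simp add: mX power_divide)
    finally have "X\<^sup>2 * (25 / (7 * m\<^sup>2)) = 25 / 63 * y\<^sup>2" .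
    moreover have "X\<^sup>2 * (25 / (7 * m\<^sup>2)) \<le> X\<^sup>2 * (a - 2 + 1 / m)"
      using a by (intro mult_left_mono) auto
    ultimately show ?thesis by linarith
  qed
  \<comment> \<open>Rewriting 1 as \<open>U + X\<^sup>2 * U\<close> extracts the positive factor
    \<open>U\<close>.\<close>
  have "X\<^sup>2 * U * (X\<^sup>2 * U / m - 2 / 3 * z * X * U\<^sup>2 + a - z) - (2 - z)
    = U * (X\<^sup>2 * (a - 2 + 1 / m) - X\<^sup>2 * U / m - 2 / 3 * z * (X^3 * U\<^sup>2) - (2 - z))
      + (U + X\<^sup>2 * U - 1) * (X\<^sup>2 * U / m + (2 - z))"
    using m by (simp add: field_simps power2_eq_square power3_eq_cube)
  also have "\<dots> = U * (X\<^sup>2 * (a - 2 + 1 / m) - X\<^sup>2 * U / m - 2 / 3 * z * (X^3 * U\<^sup>2) - (2 - z))"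
    by (simp add: UX)
  also have "\<dots> > 0"
  proof (intro mult_pos_pos U_pos)
    have "X\<^sup>2 * U / m \<le> 1 / 11" using X2U m by (simp add: field_simps)
    moreover have "2 / 3 * z * (X^3 * U\<^sup>2) \<le> 2 / 9 * z"
      using mult_left_mono[OF X3U, of "2 / 3 * z"] z by simp
    moreover have "25 / 63 * y\<^sup>2 - 1 / 11 - 2 / 9 * z - (2 - z) > 0"
    proof -
      \<comment> \<open>\<open>222 / 100\<close> is the minimiser of the quadratic to be estimated;
        its minimum is slightly above 0.\<close>
      have "(z - 222 / 100)\<^sup>2 \<ge> 0" by simp
      then show ?thesis by (simp add: y_def power2_eq_square algebra_simps)
    qed
    ultimately show "0 < X\<^sup>2 * (a - 2 + 1 / m) - X\<^sup>2 * U / m - 2 / 3 * z * (X^3 * U\<^sup>2) - (2 - z)"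
      using a' by linarith
  qed
  finally show ?thesis .
qed

section \<open>Turning points of the two branches for \<open>m \<ge> 11\<close>\<close>

context bt_saddle_loop
begin

text \<open>\<open>V\<close> is the slow line \<open>y / m\<close> times a cutoff that vanishes at
  \<open>16 / 5\<close>, on a scale of \<open>3 / m\<close>. The upper branch stays strictly below
  \<open>V\<close> up to \<open>z = 16 / 5\<close>, so it cannot be at \<open>z = 16 / 5\<close>
  with \<open>u \<ge> 0\<close>.\<close>

lemma upper_branch_short:
  assumes m: "11 \<le> m" and a: "a \<ge> 2 - 1 / m + 25 / (7 * m\<^sup>2)"
  shows "z \<tau> < 16 / 5"
proof -
  define X where "X = (\<lambda>y. m * (16 / 5 - y) / 3)"
  define U where "U = (\<lambda>y. 1 / (1 + (X y)\<^sup>2))"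
  define V where "V = (\<lambda>y. y / m * ((X y)\<^sup>2 * U y))"
  define V' where "V' = (\<lambda>y. (X y)\<^sup>2 * U y / m - 2 / 3 * y * X y * (U y)\<^sup>2)"
  have nz: "1 + (X y)\<^sup>2 \<noteq> 0" for y using zero_le_power2[of "X y"] by linarith
  have dX: "(X has_real_derivative - m / 3) (at y)" for y
    unfolding X_def by (auto intro!: derivative_eq_intros)
  have dU: "(U has_real_derivative 2 / 3 * m * X y * (U y)\<^sup>2) (at y)" for y
    unfolding U_def using nz[of y]
    by (auto intro!: derivative_eq_intros dX simp: power2_eq_square)
  have V_eq: "V = (\<lambda>y. y / m * (1 - U y))"
    unfolding V_def U_def using nz by (auto simp: field_simps)
  have dV: "(V has_real_derivative V' y) (at y)" for y
  proof -
    have "(X y)\<^sup>2 * U y = 1 - U y" unfolding U_def using nz[of y] by (simp add: field_simps)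
    moreover have "(V has_real_derivative (1 - U y) / m - 2 / 3 * y * X y * (U y)\<^sup>2) (at y)"
      unfolding V_eq using m
      by (auto intro!: derivative_eq_intros dU simp: field_simps)
    ultimately show ?thesis by (simp add: V'_def)
  qed
  define f where "f = (\<lambda>t. V (z t) - u t)"
  define f' where "f' = (\<lambda>t. m * (a - z t + V' (z t)) * f t
    - (m * V (z t) * (V' (z t) + a - z t) - z t * (2 - z t)))"
  have der: "(f has_real_derivative f' t) (at t)" for t
    unfolding f_def
    by (rule DERIV_cong[OF DERIV_diff[OF DERIV_chain2[OF dV deriv_z] deriv_u]])
      (simp add: f'_def f_def algebra_simps)
  have source: "m * V y * (V' y + a - y) - y * (2 - y) > 0" if "0 < y" "y \<le> 16 / 5" for y
  proof -
    have "m * V y * (V' y + a - y) - y * (2 - y)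
      = y * ((X y)\<^sup>2 * U y * ((X y)\<^sup>2 * U y / m - 2 / 3 * y * X y * (U y)\<^sup>2 + a - y) - (2 - y))"
      unfolding V_def V'_def using m by (simp add: field_simps)
    moreover have "(X y)\<^sup>2 * U y * ((X y)\<^sup>2 * U y / m - 2 / 3 * y * X y * (U y)\<^sup>2 + a - y) - (2 - y) > 0"
      by (rule slow_barrier_inequality[OF m a that]) (simp_all add: X_def U_def)
    ultimately show ?thesis using that by simp
  qed
  have a_ge: "a \<ge> 1"
  proof -
    have "1 / m \<le> 1" "25 / (7 * m\<^sup>2) \<ge> 0" using m by simp_all
    then show ?thesis using a by linarith
  qed
  have f_pos: "f t0 > 0" if t0: "\<tau> \<le> t0" "z t0 \<le> 16 / 5" for t0
  proof (rule pos_if_tendsto_0_at_top[OF der])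
    have "isCont V 0" using dV DERIV_isCont by blast
    then have "((\<lambda>t. V (z t)) \<longlongrightarrow> V 0) at_top" by (rule isCont_tendsto_compose[OF _ z_top])
    then have "(f \<longlongrightarrow> V 0 - 0) at_top" unfolding f_def by (intro tendsto_intros u_top)
    then show "(f \<longlongrightarrow> 0) at_top" by (simp add: V_def)
  next
    fix t assume "t0 \<le> t" "f t = 0"
    moreover have "z t \<le> 16 / 5" using z_less_after[OF t0(1), of t] t0(2) \<open>t0 \<le> t\<close> by (cases "t = t0") auto
    ultimately show "f' t < 0" using source[OF z_pos, of t] by (simp add: f'_def)
  next
    \<comment> \<open>For \<open>z < 1 / 2\<close> and \<open>a \<ge> 1\<close>, the coefficient of
      \<open>f\<close> exceeds \<open>m * (1 - 5 / 3 * z) > 0\<close>.\<close>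
    have "\<forall>\<^sub>F t in at_top. z t < 1 / 2" using z_top by (rule order_tendstoD) simp
    then show "\<forall>\<^sub>F t in at_top. f t < 0 \<longrightarrow> f' t < 0"
    proof eventually_elim
      case (elim t)
      have X_pos: "X (z t) \<ge> 0" using elim m by (simp add: X_def)
      have "X (z t) * (U (z t))\<^sup>2 \<le> 1"
      proof -
        have "X (z t) \<le> 1 + (X (z t))\<^sup>2"
          using zero_le_power2[of "X (z t) - 1"] X_pos unfolding power2_diff by simp
        also have "\<dots> \<le> (1 + (X (z t))\<^sup>2)\<^sup>2" by (rule self_le_power) auto
        finally show ?thesis unfolding U_def using nz[of "z t"] by (simp add: power_divide field_simps)
      qed
      from mult_left_mono[OF this, of "2 / 3 * z t"] have "2 / 3 * z t * X (z t) * (U (z t))\<^sup>2 \<le> 2 / 3 * z t"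
        using z_pos[of t] by (simp add: mult.assoc)
      moreover have "(X (z t))\<^sup>2 * U (z t) / m \<ge> 0" using m by (simp add: U_def)
      ultimately have "a - z t + V' (z t) > 0" unfolding V'_def using elim a_ge by linarith
      then have "f t < 0 \<Longrightarrow> m * (a - z t + V' (z t)) * f t < 0" using m by (simp add: mult_pos_neg)
      moreover have "m * V (z t) * (V' (z t) + a - z t) - z t * (2 - z t) > 0"
        using source[OF z_pos, of t] elim by simp
      ultimately show ?case unfolding f'_def by linarith
    qed
  qed
  show ?thesis
  proof (rule ccontr)
    assume *: "\<not> z \<tau> < 16 / 5"
    obtain t where t: "\<tau> \<le> t" "z t = 16 / 5"
    proof (cases "z \<tau> = 16 / 5")
      case False
      then show ?thesis using that obtain_after[of "16 / 5"] * by (metis less_imp_le not_less_iff_gr_or_eq zero_less_divide_iff zero_less_numeral)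
    qed (use that in auto)
    have "u t \<ge> 0" using u_after[of t] u_turn t(1) by (cases "t = \<tau>") auto
    then show False using f_pos[OF t(1)] t(2) by (simp add: f_def V_def X_def)
  qed
qed

text \<open>Past \<open>z = 2\<close> the restoring term changes sign and the parabola is no longer
  a barrier. Subtracting \<open>37 / 100 * (y - 2)\<^sup>2\<close> gives a barrier \<open>W\<close>
  that is still positive at \<open>16 / 5\<close>, so the branch cannot turn before.\<close>

lemma lower_branch_long:
  assumes m: "11 \<le> m" and a: "a \<ge> 2 - 1 / m"
  shows "16 / 5 \<le> z \<tau>"
proof (rule ccontr)
  assume short: "\<not> 16 / 5 \<le> z \<tau>"
  have "1 / m \<le> 1 / 11" using m by (intro divide_left_mono) auto
  then have a_ge: "19 / 10 \<le> a" using a by linarith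
  have z_turn: "z \<tau> > 2"
  proof (rule ccontr)
    assume "\<not> z \<tau> > 2"
    then have "19 / 10 * z \<tau> - (z \<tau>)\<^sup>2 / 2 < 0" using lower_branch_gt[of \<tau> "19 / 10"] a_ge u_turn by simp
    moreover have "(z \<tau>)\<^sup>2 \<le> 2 * z \<tau>" using z_pos[of \<tau>] \<open>\<not> z \<tau> > 2\<close> by (simp add: power2_eq_square)
    ultimately show False using z_pos[of \<tau>] by linarith
  qed
  define W where "W = (\<lambda>y::real. 19 / 10 * y - y\<^sup>2 / 2 - 37 / 100 * (y - 2)\<^sup>2)"
  \<comment> \<open>\<open>814 / 100\<close> is \<open>74 / 100 * m\<close> at
    \<open>m = 11\<close>. The chord of the square on the interval reduces the claim to a linear
    one.\<close>
  have W: "814 / 100 * W y > y" if "2 \<le> y" "y \<le> 16 / 5" for y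
  proof -
    have "(y - 2) * (16 / 5 - y) \<ge> 0" using that by simp
    then have "y\<^sup>2 \<le> 26 / 5 * y - 32 / 5" by (simp add: power2_eq_square field_simps)
    moreover have "W y = 338 / 100 * y - 148 / 100 - 87 / 100 * y\<^sup>2"
      by (simp add: W_def power2_eq_square field_simps)
    ultimately show ?thesis using that by linarith
  qed
  define f where "f = (\<lambda>t. - u t - W (z t))"
  define f' where "f' = (\<lambda>t. z t * (2 - z t) - m * (a - 19 / 10) * u t - 74 / 100 * m * (z t - 2) * u t)"
  have der: "(f has_real_derivative f' t) (at t)" for t
    unfolding f_def f'_def W_def
    by (auto intro!: derivative_eq_intros deriv_z deriv_u simp: field_simps power2_eq_square)
  obtain t2 where t2: "t2 < \<tau>" "z t2 = 2" using obtain_before[of 2] z_turn by auto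
  have "f t2 > 0" using lower_branch_gt[of t2 "19 / 10"] t2 a_ge by (simp add: f_def W_def)
  moreover have "f \<tau> \<le> 0" using W[of "z \<tau>"] z_turn short by (simp add: f_def u_turn)
  ultimately obtain c where c: "t2 < c" "c \<le> \<tau>" "f c = 0"
    "\<And>D. (f has_real_derivative D) (at c) \<Longrightarrow> D \<le> 0"
    by (rule first_zero[OF DERIV_isCont[OF der] _ _ t2(1)]) blast
  have zc: "2 < z c" "z c \<le> 16 / 5"
    using z_less_before[OF c(1,2)] t2 z_less_before[of c \<tau>] c(2) short by (auto simp: le_less)
  have uc: "- u c = W (z c)" using c(3) by (simp add: f_def)
  have W_pos: "W (z c) > 0" using W[of "z c"] zc by simp
  have "74 / 100 * m * W (z c) \<ge> 814 / 100 * W (z c)" using m W_pos by (intro mult_right_mono) auto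
  then have "74 / 100 * m * W (z c) > z c" using W[OF less_imp_le[OF zc(1)] zc(2)] by linarith
  then have "(z c - 2) * (74 / 100 * m * W (z c) - z c) > 0" using zc by simp
  moreover have "m * (a - 19 / 10) * W (z c) \<ge> 0" using m a_ge W_pos by simp
  moreover have "f' c = m * (a - 19 / 10) * W (z c) + (z c - 2) * (74 / 100 * m * W (z c) - z c)"
    unfolding f'_def uc[symmetric] by (simp add: algebra_simps)
  ultimately show False using c(4)[OF der] by simp
qed

lemma upper_bound_large:
  assumes "11 \<le> m"
  shows "a < 2 - 1 / m + 25 / (7 * m\<^sup>2)"
proof (rule ccontr)
  assume *: "\<not> a < 2 - 1 / m + 25 / (7 * m\<^sup>2)"
  have "25 / (7 * m\<^sup>2) \<ge> 0" by simp
  then have "a \<ge> 2 - 1 / m" using * by linarith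
  then show False using upper_branch_short lower_branch_long assms * by fastforce
qed

end

section \<open>The saddle loop in normalized coordinates\<close>

text \<open>A leftward ray avoiding \<open>S\<close> would be an unbounded connected subset of a
  bounded component.\<close>

lemma inside_meets_ray:
  fixes S :: "(real \<times> real) set"
  assumes "(c, 0) \<in> inside S"
  obtains x where "x < c" "(x, 0) \<in> S"
proof -
  let ?L = "(\<lambda>x. (x, 0)) ` {..c} :: (real \<times> real) set"
  have c: "(c, 0) \<notin> S" and bdd: "bounded (connected_component_set (- S) (c, 0))"
    using assms by (auto simp: inside_def)
  have "\<exists>x\<le>c. (x, 0) \<in> S"
  proof (rule ccontr)
    assume *: "\<not> (\<exists>x\<le>c. (x, 0) \<in> S)"
    have "connected ?L"
      by (intro connected_continuous_image continuous_intros) simp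
    then have "?L \<subseteq> connected_component_set (- S) (c, 0)"
      using * by (intro connected_component_maximal) auto
    then have "bounded ?L" using bdd bounded_subset by blast
    then have "bounded (fst ` ?L)" by (rule bounded_fst)
    moreover have "fst ` ?L = {..c}" by force
    ultimately obtain M where M: "\<And>x. x \<le> c \<Longrightarrow> \<bar>x\<bar> \<le> M" by (auto simp: bounded_real)
    show False using M[of "min c (- M - 1)"] by linarith
  qed
  then obtain x where "x \<le> c" "(x, 0) \<in> S" by blast
  then show thesis using that[of x] c by (cases "x = c") auto
qed

text \<open>Surrounding the focus enters twice: the orbit avoids it, and the orbit meets the axis to
  its left. Hence the maximum of \<open>z\<close> exceeds 2, and it is the single turning
  point.\<close>

lemma saddle_loop_normalize:
  assumes "m > 0" and "has_saddle_loop m b"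
  obtains z u \<tau> where "bt_saddle_loop m (b / m + 1) z u \<tau>"
proof -
  obtain \<phi> where sol: "bt_solution m b \<phi>" and ne: "\<exists>t. \<phi> t \<noteq> (m, 0)"
    and bot: "(\<phi> \<longlongrightarrow> (m, 0)) at_bot" and top: "(\<phi> \<longlongrightarrow> (m, 0)) at_top"
    and ins: "(- m, 0) \<in> inside (insert (m, 0) (range \<phi>))"
    using assms(2) unfolding has_saddle_loop_def by blast
  define z where "z = (\<lambda>t. 1 - fst (\<phi> t) / m)"
  define u where "u = (\<lambda>t. snd (\<phi> t) / m\<^sup>2)"
  have fst_eq: "fst (\<phi> t) = m * (1 - z t)" and snd_eq: "snd (\<phi> t) = m\<^sup>2 * u t" for t
    using \<open>m > 0\<close> by (simp_all add: z_def u_def field_simps)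
  have dphi: "(\<phi> has_vector_derivative bt_field m b (\<phi> t)) (at t)" for t
    using sol by (simp add: bt_solution_def)
  have dx: "((\<lambda>t. fst (\<phi> t)) has_real_derivative snd (\<phi> t)) (at t)" for t
    using bounded_linear.has_vector_derivative[OF bounded_linear_fst dphi[of t]]
    by (simp add: has_real_derivative_iff_has_vector_derivative bt_field_def split: prod.splits)
  have dy: "((\<lambda>t. snd (\<phi> t)) has_real_derivative
      - m\<^sup>2 + b * snd (\<phi> t) + (fst (\<phi> t))\<^sup>2 + fst (\<phi> t) * snd (\<phi> t)) (at t)" for t
    using bounded_linear.has_vector_derivative[OF bounded_linear_snd dphi[of t]]
    by (simp add: has_real_derivative_iff_has_vector_derivative bt_field_def split: prod.splits)
  have flow: "bt_flow m (m * (b / m + 1)) (- m) z u"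
  proof
    show "m > 0" by fact
    fix t
    have "(z has_real_derivative 0 - snd (\<phi> t) / m) (at t)"
      unfolding z_def by (intro DERIV_diff DERIV_const DERIV_cdivide dx)
    then show "(z has_real_derivative - (m * u t)) (at t)"
      using \<open>m > 0\<close> by (simp add: snd_eq power2_eq_square)
    have "(u has_real_derivative
        (- m\<^sup>2 + b * snd (\<phi> t) + (fst (\<phi> t))\<^sup>2 + fst (\<phi> t) * snd (\<phi> t)) / m\<^sup>2) (at t)"
      unfolding u_def by (intro DERIV_cdivide dy)
    moreover have "(- m\<^sup>2 + b * snd (\<phi> t) + (fst (\<phi> t))\<^sup>2 + fst (\<phi> t) * snd (\<phi> t)) / m\<^sup>2
        = - (z t * (2 - z t)) + (m * (b / m + 1) + - m * z t) * u t"
      unfolding fst_eq snd_eq using \<open>m > 0\<close> by (simp add: field_simps power2_eq_square)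
    ultimately show "(u has_real_derivative
        - (z t * (2 - z t)) + (m * (b / m + 1) + - m * z t) * u t) (at t)" by simp
  qed
  have lim: "(z \<longlongrightarrow> 0) G \<and> (u \<longlongrightarrow> 0) G" if "(\<phi> \<longlongrightarrow> (m, 0)) G" for G
  proof -
    have "(z \<longlongrightarrow> 1 - m / m) G" unfolding z_def using tendsto_fst[OF that] \<open>m > 0\<close>
      by (intro tendsto_intros) auto
    moreover have "(u \<longlongrightarrow> 0 / m\<^sup>2) G" unfolding u_def using tendsto_snd[OF that] \<open>m > 0\<close>
      by (intro tendsto_intros) auto
    ultimately show ?thesis using \<open>m > 0\<close> by simp
  qed
  interpret bt_homoclinic m "m * (b / m + 1)" "- m" z u
  proof (intro bt_homoclinic.intro flow bt_homoclinic_axioms.intro)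
    obtain t where "\<phi> t \<noteq> (m, 0)" using ne by blast
    then have "z t \<noteq> 0 \<or> u t \<noteq> 0"
      using fst_eq[of t] snd_eq[of t] by (cases "\<phi> t") auto
    then show "\<exists>t. z t \<noteq> 0 \<or> u t \<noteq> 0" by blast
  qed (use lim[OF top] lim[OF bot] in auto)
  have "(- m, 0) \<notin> range \<phi>" using ins by (auto simp: inside_def)
  have no_focus: "\<not> (z t = 2 \<and> u t = 0)" for t
  proof
    assume "z t = 2 \<and> u t = 0"
    then have "\<phi> t = (- m, 0)" by (simp add: prod_eq_iff fst_eq snd_eq)
    then show False using \<open>(- m, 0) \<notin> range \<phi>\<close> by (metis rangeI)
  qed
  obtain x where x: "x < - m" "(x, 0) \<in> insert (m, 0) (range \<phi>)" by (rule inside_meets_ray[OF ins])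
  then obtain t0 where "fst (\<phi> t0) < - m" using \<open>m > 0\<close> by (auto simp: image_iff) (metis fst_conv)
  then have zt0: "z t0 > 2" using \<open>m > 0\<close> by (simp add: z_def field_simps)
  obtain \<tau> where max: "\<And>t. z t \<le> z \<tau>"
    using attains_max_if_tendsto_0[OF continuous_z z_top z_bot z_pos] by blast
  have z\<tau>: "z \<tau> > 2" using zt0 max[of t0] by simp
  have "- (m * u \<tau>) = 0"
    by (rule DERIV_local_max[OF deriv_z zero_less_one]) (use max in auto)
  then have u\<tau>: "u \<tau> = 0" using \<open>m > 0\<close> by simp
  have "bt_saddle_loop m (b / m + 1) z u \<tau>"
  proof (intro bt_saddle_loop.intro bt_saddle_loop_axioms.intro bt_homoclinic_axioms)
    show "u t > 0" if "\<tau> < t" for t using u_pos_after_max[OF max z\<tau> u\<tau> no_focus that] .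
    show "u t < 0" if "t < \<tau>" for t using u_neg_before_max[OF max z\<tau> u\<tau> no_focus that] .
  qed (rule u\<tau>)
  then show thesis by (rule that)
qed

text \<open>The difference of the two bounds is a positive multiple of \<open>m - 7\<close>.\<close>

lemma upper_bounds_cross:
  fixes m :: real
  assumes "m > 0"
  shows "7 \<le> m \<Longrightarrow> m - 1 + 25 / (7 * m) \<le> (5 + 37 / 12 * m) * m / (7 + 37 / 12 * m)"
    and "m \<le> 7 \<Longrightarrow> (5 + 37 / 12 * m) * m / (7 + 37 / 12 * m) \<le> m - 1 + 25 / (7 * m)"
proof -
  have d: "7 + 37 / 12 * m > 0" using assms by simp
  have eq: "(5 + 37 / 12 * m) * m / (7 + 37 / 12 * m) - (m - 1 + 25 / (7 * m))
      = (m - 7) * (91 / 12 * m + 25) / (7 * m * (7 + 37 / 12 * m))"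
    using assms d by (simp add: divide_simps) (simp add: algebra_simps)
  show "7 \<le> m \<Longrightarrow> m - 1 + 25 / (7 * m) \<le> (5 + 37 / 12 * m) * m / (7 + 37 / 12 * m)"
  proof -
    assume "7 \<le> m"
    then have "(m - 7) * (91 / 12 * m + 25) / (7 * m * (7 + 37 / 12 * m)) \<ge> 0" using assms by simp
    then show ?thesis using eq by linarith
  qed
  show "m \<le> 7 \<Longrightarrow> (5 + 37 / 12 * m) * m / (7 + 37 / 12 * m) \<le> m - 1 + 25 / (7 * m)"
  proof -
    assume "m \<le> 7"
    then have "(m - 7) * (91 / 12 * m + 25) / (7 * m * (7 + 37 / 12 * m)) \<le> 0"
      using assms by (intro divide_nonpos_pos mult_nonpos_nonneg) auto
    then show ?thesis using eq by linarith
  qed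
qed

section \<open>Assembly of the bounds\<close>

theorem theorem2:
  fixes m :: real
  assumes "m > 0"
    and "\<exists>!B. limit_cycle_threshold m B"
    and "has_saddle_loop m (b_star m)"
  shows "max (5 * m / 7) (m - 1) < b_star m \<and>
         b_star m < min ((5 + 37 / 12 * m) * m / (7 + 37 / 12 * m)) (m - 1 + 25 / (7 * m))"
proof -
  define b where "b = b_star m"
  obtain z u \<tau> where "bt_saddle_loop m (b / m + 1) z u \<tau>"
    using saddle_loop_normalize[OF assms(1,3)] unfolding b_def by blast
  then interpret bt_saddle_loop m "b / m + 1" z u \<tau> .
  have line: "m - 1 < b"
    using line_barrier \<open>m > 0\<close> by (simp add: distrib_left)
  have low: "5 * m / 7 < b"
  \<comment> \<open>For \<open>m > 7 / 2\<close> the line barrier suffices, since then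
    \<open>m - 1 > 5 * m / 7\<close>.\<close>
  proof (cases "m \<le> 7 / 2")
    case True
    from lower_bound_small[OF this] show ?thesis using \<open>m > 0\<close> by (simp add: field_simps)
  qed (use line in linarith)
  have up1: "b < (5 + 37 / 12 * m) * m / (7 + 37 / 12 * m)" if "m \<le> 7"
  proof -
    have d: "7 + 37 / 12 * m > 0" using \<open>m > 0\<close> by simp
    have "b / m < 1 - 2 / (7 + 37 / 12 * m)" using upper_bound_small[OF that] by simp
    then have "b < m * (1 - 2 / (7 + 37 / 12 * m))"
      using \<open>m > 0\<close> by (simp add: pos_divide_less_eq mult.commute)
    also have "\<dots> = (5 + 37 / 12 * m) * m / (7 + 37 / 12 * m)" using d by (simp add: field_simps)
    finally show ?thesis .
  qed
  have up2: "b < m - 1 + 25 / (7 * m)" if "7 \<le> m"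
  proof -
    have "b / m + 1 < 2 - 1 / m + 25 / (7 * m\<^sup>2)"
      using upper_bound_medium[OF that] upper_bound_large by linarith
    then have "b / m < 1 - 1 / m + 25 / (7 * m\<^sup>2)" by simp
    then have "b < m * (1 - 1 / m + 25 / (7 * m\<^sup>2))"
      using \<open>m > 0\<close> by (simp add: pos_divide_less_eq mult.commute)
    also have "\<dots> = m - 1 + 25 / (7 * m)" using \<open>m > 0\<close> by (simp add: field_simps power2_eq_square)
    finally show ?thesis .
  qed
  have "b < (5 + 37 / 12 * m) * m / (7 + 37 / 12 * m) \<and> b < m - 1 + 25 / (7 * m)"
    using up1 up2 upper_bounds_cross[OF \<open>m > 0\<close>] by (cases "m \<le> 7") force+
  then show ?thesis using line low unfolding b_def by simp
qed

end
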